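(* For every odd prime $p$ and every $\alpha\in\mathbb{N}$, $\mathrm{BGGM}\notin\mathrm{AC}^0[p^{\alpha}]$.
   Context: A grid layered planar graph is a planar graph embedded in the integer lattice such that every edge joins lattice points $(a,b),(c,d)$ with $|a-c|\le1$. $\mathrm{BGGM}$ is the language of (encodings of) bipartite grid layered planar graphs, given together with their lattice embedding, that have a perfect matching. For $m\ge2$, $\mathrm{AC}^0[m]$ is the class of languages decided by (non-uniform) families of constant-depth, polynomial-size circuits with unbounded fan-in AND, OR, NOT and $\mathrm{Mod}_m$ gates, where a $\mathrm{Mod}_m$ gate outputs 1 iff the number of 1's among its inputs is not divisible by $m$. *)

theory Defs
  imports "HOL-Analysis.Analysis" "HOL-Computational_Algebra.Primes"
begin

section \<open>Circuits with modular counting gates\<close>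

text \<open>
  A circuit on \<open>n\<close> inputs is a directed acyclic graph given in topological order:
  wires \<open>0, \<dots>, n - 1\<close> are the inputs, and wire \<open>n + k\<close> is the output of the \<open>k\<close>-th gate,
  which may only read wires with smaller numbers. Fan-in is unbounded, and parallel wires
  into one gate are allowed (they count with multiplicity in a modular gate).
\<close>

datatype gate =
    And_Gate "nat list"
  | Or_Gate "nat list"
  | Not_Gate nat
  | Mod_Gate "nat list"

record circuit =
  gates :: "gate list"
  out_wire :: nat

primrec gate_inputs :: "gate \<Rightarrow> nat list" where
  "gate_inputs (And_Gate is) = is"
| "gate_inputs (Or_Gate is) = is"
| "gate_inputs (Not_Gate i) = [i]"
| "gate_inputs (Mod_Gate is) = is"

primrec gate_value :: "nat \<Rightarrow> bool list \<Rightarrow> gate \<Rightarrow> bool" where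
  "gate_value m vs (And_Gate is) = (\<forall>i \<in> set is. vs ! i)"
| "gate_value m vs (Or_Gate is) = (\<exists>i \<in> set is. vs ! i)"
| "gate_value m vs (Not_Gate i) = (\<not> vs ! i)"
| "gate_value m vs (Mod_Gate is) = (\<not> m dvd length (filter (\<lambda>i. vs ! i) is))"

definition wf_circuit :: "nat \<Rightarrow> circuit \<Rightarrow> bool" where
  "wf_circuit n C \<longleftrightarrow>
     (\<forall>k < length (gates C). \<forall>i \<in> set (gate_inputs (gates C ! k)). i < n + k) \<and>
     out_wire C < n + length (gates C)"

definition wire_values :: "nat \<Rightarrow> circuit \<Rightarrow> bool list \<Rightarrow> bool list" where
  "wire_values m C xs = foldl (\<lambda>vs g. vs @ [gate_value m vs g]) xs (gates C)"

definition circuit_value :: "nat \<Rightarrow> circuit \<Rightarrow> bool list \<Rightarrow> bool" where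
  "circuit_value m C xs = wire_values m C xs ! out_wire C"

definition wire_depths :: "nat \<Rightarrow> circuit \<Rightarrow> nat list" where
  "wire_depths n C =
     foldl (\<lambda>ds g. ds @ [Suc (Max (insert 0 ((\<lambda>i. ds ! i) ` set (gate_inputs g))))])
       (replicate n 0) (gates C)"

definition circuit_depth :: "nat \<Rightarrow> circuit \<Rightarrow> nat" where
  "circuit_depth n C = Max (insert 0 (set (wire_depths n C)))"

text \<open>Wires are counted as well, since the number of gates does not bound the multiplicities of
  parallel wires.\<close>

definition circuit_size :: "circuit \<Rightarrow> nat" where
  "circuit_size C = length (gates C) + (\<Sum>g\<leftarrow>gates C. length (gate_inputs g))"

text \<open>
  The class of languages decided by non-uniform constant-depth polynomial-size circuit families
  whose modular gates have modulus \<open>m\<close>. A function of \<open>n\<close> is polynomially bounded iff it is at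
  most \<open>n ^ k + k\<close> for some \<open>k\<close>.
\<close>

definition AC0_mod :: "nat \<Rightarrow> bool list set set" where
  "AC0_mod m =
     {L. \<exists>(C :: nat \<Rightarrow> circuit) d k. \<forall>n.
           wf_circuit n (C n) \<and>
           circuit_depth n (C n) \<le> d \<and>
           circuit_size (C n) \<le> n ^ k + k \<and>
           (\<forall>xs. length xs = n \<longrightarrow> (circuit_value m (C n) xs \<longleftrightarrow> xs \<in> L))}"


section \<open>Grid layered planar graphs\<close>

text \<open>
  The vertices of an embedded graph are identified with the lattice points they are placed at;
  edges are unordered pairs of vertices, drawn as straight line segments.
\<close>

type_synonym point = "int \<times> int"

definition simple_graph :: "'a set \<Rightarrow> 'a set set \<Rightarrow> bool" where
  "simple_graph V E \<longleftrightarrow> finite V \<and> (\<forall>e \<in> E. e \<subseteq> V \<and> card e = 2)"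

definition bipartite :: "'a set \<Rightarrow> 'a set set \<Rightarrow> bool" where
  "bipartite V E \<longleftrightarrow>
     (\<exists>A B. A \<union> B = V \<and> A \<inter> B = {} \<and> (\<forall>e \<in> E. \<exists>a \<in> A. \<exists>b \<in> B. e = {a, b}))"

definition perfect_matching :: "'a set \<Rightarrow> 'a set set \<Rightarrow> 'a set set \<Rightarrow> bool" where
  "perfect_matching V E M \<longleftrightarrow> M \<subseteq> E \<and> (\<forall>v \<in> V. \<exists>!e. e \<in> M \<and> v \<in> e)"

definition real_point :: "point \<Rightarrow> real \<times> real" where
  "real_point = (\<lambda>(a, b). (real_of_int a, real_of_int b))"

text \<open>
  The convex hull of the two endpoints is the segment drawn for an edge. The drawing is a plane
  embedding iff a segment meets the vertex set only in its endpoints, and two different segments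
  meet at most in a common endpoint.
\<close>

definition segment :: "point set \<Rightarrow> (real \<times> real) set" where
  "segment e = convex hull (real_point ` e)"

definition plane_drawing :: "point set \<Rightarrow> point set set \<Rightarrow> bool" where
  "plane_drawing V E \<longleftrightarrow>
     (\<forall>e \<in> E. segment e \<inter> real_point ` V = real_point ` e) \<and>
     (\<forall>e \<in> E. \<forall>f \<in> E. e \<noteq> f \<longrightarrow> segment e \<inter> segment f = real_point ` (e \<inter> f))"

definition grid_layered_planar :: "point set \<Rightarrow> point set set \<Rightarrow> bool" where
  "grid_layered_planar V E \<longleftrightarrow>
     simple_graph V E \<and> plane_drawing V E \<and>
     (\<forall>a b c d. {(a, b), (c, d)} \<in> E \<longrightarrow> \<bar>a - c\<bar> \<le> 1)"


section \<open>Encoding as bit strings\<close>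

text \<open>
  An embedded graph with \<open>N\<close> vertices is encoded by \<open>N\<close> and a coordinate width \<open>w\<close>, both in unary
  and terminated by a zero, followed by the coordinates of the vertices, listed in some
  order without repetition, and the adjacency matrix with respect to that order. Each coordinate
  is written in two's complement with \<open>w + 1\<close> bits, least significant bit first.
\<close>

definition int_bits :: "nat \<Rightarrow> int \<Rightarrow> bool list" where
  "int_bits w z = map (bit z) [0..<Suc w]"

definition encode_graph :: "nat \<Rightarrow> point list \<Rightarrow> point set set \<Rightarrow> bool list" where
  "encode_graph w vs E =
     replicate (length vs) True @ [False] @ replicate w True @ [False] @
     concat (map (\<lambda>(a, b). int_bits w a @ int_bits w b) vs) @
     concat (map (\<lambda>u. map (\<lambda>v. {u, v} \<in> E) vs) vs)"

definition encodes :: "bool list \<Rightarrow> point set \<Rightarrow> point set set \<Rightarrow> bool" where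
  "encodes s V E \<longleftrightarrow>
     (\<exists>w vs. distinct vs \<and> set vs = V \<and>
        (\<forall>(a, b) \<in> V. a \<in> {- (2 ^ w)..<2 ^ w} \<and> b \<in> {- (2 ^ w)..<2 ^ w}) \<and>
        s = encode_graph w vs E)"

definition BGGM :: "bool list set" where
  "BGGM =
     {s. \<exists>V E. encodes s V E \<and> grid_layered_planar V E \<and> bipartite V E \<and>
           (\<exists>M. perfect_matching V E M)}"

lemma unary_inj:
  "replicate m True @ False # xs = replicate n True @ False # ys \<Longrightarrow> m = n \<and> xs = ys"
proof (induction m arbitrary: n)
  case 0
  then show ?case by (cases n) auto
next
  case (Suc m)
  then show ?case by (cases n) auto
qed

lemma int_bits_inj:
  assumes "int_bits w a = int_bits w b" "a \<in> {- (2 ^ w)..<2 ^ w}" "b \<in> {- (2 ^ w)..<2 ^ w}"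
  shows "a = b"
proof -
  have "bit a n = bit b n" if "n \<le> w" for n
    using assms(1) that unfolding int_bits_def by (simp add: less_Suc_eq_le del: upt_Suc)
  then have "signed_take_bit w a = signed_take_bit w b"
    by (intro bit_eqI) (auto simp: bit_signed_take_bit_iff)
  moreover have "signed_take_bit w a = a" "signed_take_bit w b = b"
    using assms(2,3) by (auto simp: signed_take_bit_int_eq_self_iff)
  ultimately show ?thesis by simp
qed

lemma map_concat_inj:
  assumes "concat (map f xs) @ r = concat (map g ys) @ t" "length xs = length ys"
    "\<And>x y. length (f x) = l" "\<And>y. length (g y) = l"
  shows "map f xs = map g ys \<and> r = t"
  using assms(2,1) by (induction xs ys rule: list_induct2) (auto simp: assms(3,4))

lemma encodes_unique:
  assumes "encodes s V E" "encodes s V' E'" "simple_graph V E" "simple_graph V' E'"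
  shows "V = V' \<and> E = E'"
proof -
  obtain w vs where vs: "distinct vs" "set vs = V" "s = encode_graph w vs E"
      "\<And>a b. (a, b) \<in> V \<Longrightarrow> a \<in> {- (2 ^ w)..<2 ^ w} \<and> b \<in> {- (2 ^ w)..<2 ^ w}"
    using assms(1) unfolding encodes_def by blast
  obtain w' vs' where vs': "distinct vs'" "set vs' = V'" "s = encode_graph w' vs' E'"
      "\<And>a b. (a, b) \<in> V' \<Longrightarrow> a \<in> {- (2 ^ w')..<2 ^ w'} \<and> b \<in> {- (2 ^ w')..<2 ^ w'}"
    using assms(2) unfolding encodes_def by blast
  let ?f = "\<lambda>w (a, b). int_bits w a @ int_bits w b"
  let ?g = "\<lambda>vs E u. map (\<lambda>v. {u, v} \<in> E) vs"
  have eq: "encode_graph w vs E = encode_graph w' vs' E'"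
    using vs(3) vs'(3) by simp
  then have len: "length vs = length vs'"
    unfolding encode_graph_def append_Cons append_Nil by (rule unary_inj[THEN conjunct1])
  have "replicate w True @ False # concat (map (?f w) vs) @ concat (map (?g vs E) vs) =
        replicate w' True @ False # concat (map (?f w') vs') @ concat (map (?g vs' E') vs')"
    using eq unfolding encode_graph_def append_Cons append_Nil by (rule unary_inj[THEN conjunct2])
  from unary_inj[OF this] have w: "w = w'"
    and eq2: "concat (map (?f w) vs) @ concat (map (?g vs E) vs) =
          concat (map (?f w') vs') @ concat (map (?g vs' E') vs')"
    by blast+
  have lf: "length (?f w p) = 2 * Suc w" for w p
    by (cases p) (simp add: int_bits_def del: upt_Suc)
  have c: "map (?f w) vs = map (?f w') vs'"
    and d: "concat (map (?g vs E) vs) = concat (map (?g vs' E') vs')"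
    using map_concat_inj[OF eq2 len, of "2 * Suc w"] lf w by simp_all
  have same: "vs = vs'"
  proof (rule nth_equalityI[OF len])
    fix i assume i: "i < length vs"
    obtain a b where p: "vs ! i = (a, b)" by fastforce
    obtain a' b' where q: "vs' ! i = (a', b')" by fastforce
    have "?f w (vs ! i) = ?f w' (vs' ! i)"
      using arg_cong[OF c, of "\<lambda>xs. xs ! i"] i len by simp
    then have "int_bits w a = int_bits w a'" "int_bits w b = int_bits w b'"
      using p q w by (simp_all add: int_bits_def del: upt_Suc)
    moreover have "(a, b) \<in> V" "(a', b') \<in> V'"
      using p q i len vs(2) vs'(2) nth_mem[of i vs] nth_mem[of i vs'] by simp_all
    ultimately show "vs ! i = vs' ! i"
      using int_bits_inj[of w a a'] int_bits_inj[of w b b'] vs(4)[of a b] vs'(4)[of a' b'] p q w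
      by simp
  qed
  have "map (?g vs E) vs = map (?g vs E') vs"
    using map_concat_inj[of "?g vs E" vs "[]" "?g vs E'" vs "[]" "length vs"] d same by simp
  then have adj: "{u, v} \<in> E \<longleftrightarrow> {u, v} \<in> E'" if "u \<in> V" "v \<in> V" for u v
    using that vs(2) by auto
  have V: "V = V'" using same vs(2) vs'(2) by simp
  have "e \<in> E \<longleftrightarrow> e \<in> E'" for e
  proof (cases "e \<subseteq> V \<and> card e = 2")
    case True
    then obtain u v where "e = {u, v}" by (auto simp: card_2_iff)
    with True adj show ?thesis by auto
  next
    case False
    then show ?thesis using assms(3,4) V unfolding simple_graph_def by blast
  qed
  with V show ?thesis by blast
qed

lemma encodes_exists:
  assumes "finite V"
  shows "\<exists>s. encodes s V E"
proof -
  obtain vs where vs: "distinct vs" "set vs = V"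
    using assms finite_distinct_list by blast
  define K where "K = (\<Sum>(a, b) \<in> V. \<bar>a\<bar> + \<bar>b\<bar>)"
  have K: "\<bar>a\<bar> + \<bar>b\<bar> \<le> K" if "(a, b) \<in> V" for a b
    unfolding K_def using member_le_sum[OF that, of "\<lambda>(a, b). \<bar>a\<bar> + \<bar>b\<bar>"] assms by auto
  have "0 \<le> K" unfolding K_def by (rule sum_nonneg) auto
  moreover have "int (nat K) < 2 ^ nat K" by (rule of_nat_less_two_power)
  ultimately have "K < 2 ^ nat K" by simp
  then have "\<forall>(a, b) \<in> V. a \<in> {- (2 ^ nat K)..<2 ^ nat K} \<and> b \<in> {- (2 ^ nat K)..<2 ^ nat K}"
    using K by fastforce
  with vs show ?thesis unfolding encodes_def by blast
qed

end

(*
  Parity reduces to BGGM. Vertex (0, i) is inserted into one of two vertical paths, in column 1 or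
  in column -1, between rows i and i + 1, according to the i-th input bit. Both paths are
  straight-line drawn on the lattice, and for even n both have an even number of vertices, i.e. the
  graph has a perfect matching, iff the number of ones is odd. Every bit of the encoding is a
  constant, an input bit or a negated input bit.

  It remains to run the Razborov-Smolensky argument modulo the odd prime p. A gate is approximated
  modulo p by a polynomial whose degree grows by a factor polylogarithmic in n: an OR by random
  subsums and Fermat's little theorem, a Mod gate with modulus q = p^a exactly, because the
  indicator of q dvd N is the sum of (-1)^j (N choose j) over j < q modulo p. A low-degree
  polynomial that agrees with parity on a set G lets every function on G be written with degree
  about n/2, and comparing the numbers of functions and of polynomials bounds the size of G.
*)

theory Submission
  imports Defs "HOL-Number_Theory.Residues"
begin

text \<open>No circuit for parity is built from one for BGGM. The given circuit is fed its
  \<open>N\<close> code bits as affine functions of the \<open>n\<close> input bits, and errors are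
  counted over the \<open>2 ^ n\<close> inputs, never over all strings of length \<open>N\<close>.
  Hence the vertex order and the code length must not depend on the input. The path lengths are
  \<open>n + 1 + |S|\<close> and \<open>2n + 1 - |S|\<close>; their sum \<open>3n + 2\<close> is
  even for even \<open>n\<close>, so one path cannot have a perfect matching without the other.
  Oddness of \<open>p\<close> enters through the passage from values 0, 1 to values 1, -1, which has
  to be inverted modulo \<open>p\<close>.

  The parameters balance two demands. Each gate errs on a fraction of at most
  \<open>2 ^ (-t)\<close> of the inputs, so \<open>t\<close> of order log n brings the error of a
  polynomial-size circuit down to a quarter. The degree is then polylogarithmic, while polynomials
  of degree up to about a quarter of the square root of n still err on more than a quarter of the
  inputs. With \<open>n = 2 ^ s\<close> the logarithm is a natural number. Polynomials have integer
  values and are compared by congruence, so signs and binomial coefficients need no embedding into a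
  finite field.\<close>

section \<open>Polynomials of low degree\<close>

text \<open>A point of the cube \<open>{0, 1}\<^sup>n\<close> is identified with the set of its ones, so that
  \<open>of_bool (T \<subseteq> S)\<close> is the value at \<open>S\<close> of the multilinear monomial with variables \<open>T\<close>.\<close>

definition lowdeg :: "nat \<Rightarrow> nat \<Rightarrow> (nat set \<Rightarrow> int) set" where
  "lowdeg n d = {f. \<exists>c. \<forall>S. S \<subseteq> {..<n} \<longrightarrow>
     f S = (\<Sum>T | T \<subseteq> {..<n} \<and> card T \<le> d. c T * of_bool (T \<subseteq> S))}"

lemma lowdegI:
  assumes "\<And>S. S \<subseteq> {..<n} \<Longrightarrow>
    f S = (\<Sum>T | T \<subseteq> {..<n} \<and> card T \<le> d. c T * of_bool (T \<subseteq> S))"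
  shows "f \<in> lowdeg n d"
  unfolding lowdeg_def using assms by blast

lemma lowdegE:
  assumes "f \<in> lowdeg n d"
  obtains c where "\<And>S. S \<subseteq> {..<n} \<Longrightarrow>
    f S = (\<Sum>T | T \<subseteq> {..<n} \<and> card T \<le> d. c T * of_bool (T \<subseteq> S))"
  using assms unfolding lowdeg_def by blast

lemma finite_low_subsets [simp]: "finite {T. T \<subseteq> {..<n::nat} \<and> P T}"
  by (rule finite_subset[of _ "Pow {..<n}"]) auto

lemma lowdeg_cong:
  assumes "f \<in> lowdeg n d" "\<And>S. S \<subseteq> {..<n} \<Longrightarrow> f S = g S"
  shows "g \<in> lowdeg n d"
  using assms unfolding lowdeg_def by auto

lemma lowdeg_add:
  assumes "f \<in> lowdeg n d" "g \<in> lowdeg n d"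
  shows "(\<lambda>S. f S + g S) \<in> lowdeg n d"
proof -
  obtain c where
    "\<And>S. S \<subseteq> {..<n} \<Longrightarrow> f S = (\<Sum>T | T \<subseteq> {..<n} \<and> card T \<le> d. c T * of_bool (T \<subseteq> S))"
    by (rule lowdegE[OF assms(1)]) blast
  moreover obtain c' where
    "\<And>S. S \<subseteq> {..<n} \<Longrightarrow> g S = (\<Sum>T | T \<subseteq> {..<n} \<and> card T \<le> d. c' T * of_bool (T \<subseteq> S))"
    by (rule lowdegE[OF assms(2)]) blast
  ultimately have "\<And>S. S \<subseteq> {..<n} \<Longrightarrow>
      f S + g S = (\<Sum>T | T \<subseteq> {..<n} \<and> card T \<le> d. (c T + c' T) * of_bool (T \<subseteq> S))"
    by (simp add: sum.distrib distrib_right del: sum_mult_of_bool_eq sum_of_bool_mult_eq)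
  then show ?thesis by (rule lowdegI)
qed

lemma lowdeg_cmult:
  assumes "f \<in> lowdeg n d"
  shows "(\<lambda>S. a * f S) \<in> lowdeg n d"
proof -
  obtain c where
    "\<And>S. S \<subseteq> {..<n} \<Longrightarrow> f S = (\<Sum>T | T \<subseteq> {..<n} \<and> card T \<le> d. c T * of_bool (T \<subseteq> S))"
    by (rule lowdegE[OF assms]) blast
  then have "\<And>S. S \<subseteq> {..<n} \<Longrightarrow>
      a * f S = (\<Sum>T | T \<subseteq> {..<n} \<and> card T \<le> d. (a * c T) * of_bool (T \<subseteq> S))"
    by (simp add: sum_distrib_left mult.assoc del: sum_mult_of_bool_eq sum_of_bool_mult_eq)
  then show ?thesis by (rule lowdegI)
qed

lemma lowdeg_diff:
  assumes "f \<in> lowdeg n d" "g \<in> lowdeg n d"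
  shows "(\<lambda>S. f S - g S) \<in> lowdeg n d"
  using lowdeg_add[OF assms(1) lowdeg_cmult[OF assms(2), of "-1"]] by simp

lemma lowdeg_monomial:
  assumes "T \<subseteq> {..<n}" "card T \<le> d"
  shows "(\<lambda>S. of_bool (T \<subseteq> S)) \<in> lowdeg n d"
proof -
  have "of_bool (T \<subseteq> S) =
      (\<Sum>T' | T' \<subseteq> {..<n} \<and> card T' \<le> d. of_bool (T' = T) * of_bool (T' \<subseteq> S) :: int)" for S
  proof -
    have "(\<Sum>T' | T' \<subseteq> {..<n} \<and> card T' \<le> d. of_bool (T' = T) * of_bool (T' \<subseteq> S) :: int) =
        (\<Sum>T' | T' \<subseteq> {..<n} \<and> card T' \<le> d. if T' = T then of_bool (T \<subseteq> S) else 0)"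
      by (rule sum.cong) auto
    also have "\<dots> = of_bool (T \<subseteq> S)"
      using assms by (subst sum.delta) auto
    finally show ?thesis ..
  qed
  then show ?thesis by (rule lowdegI)
qed

lemma lowdeg_const [simp]: "(\<lambda>S. a) \<in> lowdeg n d"
  using lowdeg_cmult[OF lowdeg_monomial[of "{}" n d], of a] by simp

lemma lowdeg_sum:
  assumes "\<And>i. i \<in> I \<Longrightarrow> f i \<in> lowdeg n d"
  shows "(\<lambda>S. \<Sum>i\<in>I. f i S) \<in> lowdeg n d"
  using assms
proof (induction I rule: infinite_finite_induct)
  case (insert i I)
  then show ?case using lowdeg_add[of "f i" n d "\<lambda>S. \<Sum>i\<in>I. f i S"] by simp
qed simp_all

text \<open>The monomials of \<open>T\<close> and \<open>T'\<close> multiply to that of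
  \<open>T \<union> T'\<close>, as \<open>x * x = x\<close> on the cube; so the product is
  multilinear again.\<close>

lemma lowdeg_mult:
  assumes "f \<in> lowdeg n d" "g \<in> lowdeg n e"
  shows "(\<lambda>S. f S * g S) \<in> lowdeg n (d + e)"
proof -
  let ?A = "\<lambda>d. {T. T \<subseteq> {..<n} \<and> card T \<le> d}"
  obtain c where c: "\<And>S. S \<subseteq> {..<n} \<Longrightarrow> f S = (\<Sum>T\<in>?A d. c T * of_bool (T \<subseteq> S))"
    by (rule lowdegE[OF assms(1)]) blast
  obtain c' where c':
    "\<And>S. S \<subseteq> {..<n} \<Longrightarrow> g S = (\<Sum>T\<in>?A e. c' T * of_bool (T \<subseteq> S))"
    by (rule lowdegE[OF assms(2)]) blast
  have "(\<lambda>S. \<Sum>T\<in>?A d. \<Sum>T'\<in>?A e. (c T * c' T') * of_bool (T \<union> T' \<subseteq> S)) \<in> lowdeg n (d + e)"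
    by (intro lowdeg_sum lowdeg_cmult lowdeg_monomial)
       (auto intro: order.trans[OF card_Un_le] add_mono)
  then show ?thesis
  proof (rule lowdeg_cong)
    fix S assume S: "S \<subseteq> {..<n}"
    show "(\<Sum>T\<in>?A d. \<Sum>T'\<in>?A e. (c T * c' T') * of_bool (T \<union> T' \<subseteq> S)) = f S * g S"
      unfolding c[OF S] c'[OF S] sum_product
      by (intro sum.cong refl) auto
  qed
qed

lemma lowdeg_mono:
  assumes "f \<in> lowdeg n d" "d \<le> e"
  shows "f \<in> lowdeg n e"
  using lowdeg_mult[OF assms(1) lowdeg_const[of 1 n "e - d"]] assms(2) by simp

lemma lowdeg_prod:
  assumes "\<And>i. i \<in> I \<Longrightarrow> f i \<in> lowdeg n d"
  shows "(\<lambda>S. \<Prod>i\<in>I. f i S) \<in> lowdeg n (card I * d)"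
  using assms
proof (induction I rule: infinite_finite_induct)
  case (insert i I)
  then show ?case using lowdeg_mult[of "f i" n d "\<lambda>S. \<Prod>i\<in>I. f i S" "card I * d"] by simp
qed simp_all

lemma lowdeg_power:
  assumes "f \<in> lowdeg n d"
  shows "(\<lambda>S. f S ^ k) \<in> lowdeg n (k * d)"
  using lowdeg_prod[of "{..<k}" "\<lambda>_. f" n d] assms by simp

lemma lowdeg_coord:
  assumes "i < n" "1 \<le> d"
  shows "(\<lambda>S. of_bool (i \<in> S)) \<in> lowdeg n d"
  using lowdeg_monomial[of "{i}" n d] assms by simp

section \<open>Parity is not approximable by polynomials of low degree\<close>

text \<open>Counting replaces a dimension argument: coefficients matter only modulo
  \<open>p\<close>, so there are at most \<open>p ^ card ?A\<close> polynomials, and they have to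
  realise all \<open>p ^ card G\<close> residue functions on \<open>G\<close>.\<close>

lemma card_le_of_lowdeg_span:
  fixes p :: nat
  assumes "1 < p" and G: "G \<subseteq> Pow {..<n}"
    and span: "\<And>f. \<exists>g \<in> lowdeg n d. \<forall>S \<in> G. [f S = g S] (mod int p)"
  shows "card G \<le> card {T. T \<subseteq> {..<n} \<and> card T \<le> d}"
proof -
  let ?A = "{T. T \<subseteq> {..<n} \<and> card T \<le> d}"
  let ?V = "{0..<int p}"
  \<comment> \<open>Cutting \<open>ev c\<close> off outside \<open>G\<close> makes it an extensional
    function, so that domain and target are finite function spaces of known size.\<close>
  define ev where "ev c = (\<lambda>S\<in>G. (\<Sum>T\<in>?A. c T * of_bool (T \<subseteq> S)) mod int p)" for c
  have finG: "finite G" using finite_subset[OF G] by simp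
  have "(G \<rightarrow>\<^sub>E ?V) \<subseteq> ev ` (?A \<rightarrow>\<^sub>E ?V)"
  proof
    fix f assume f: "f \<in> G \<rightarrow>\<^sub>E ?V"
    obtain g where g: "g \<in> lowdeg n d" "\<forall>S\<in>G. [f S = g S] (mod int p)"
      by (rule bexE[OF span[of f]])
    obtain c where c: "\<And>S. S \<subseteq> {..<n} \<Longrightarrow> g S = (\<Sum>T\<in>?A. c T * of_bool (T \<subseteq> S))"
      by (rule lowdegE[OF g(1)]) blast
    let ?c = "\<lambda>T\<in>?A. c T mod int p"
    have "f S = ev ?c S" if S: "S \<in> G" for S
    proof -
      have reduce: "(c T * of_bool (T \<subseteq> S)) mod int p = (?c T * of_bool (T \<subseteq> S)) mod int p"
        if "T \<in> ?A" for T using that by simp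
      have "f S \<in> ?V" using f S by blast
      then have "f S = f S mod int p" by simp
      also have "\<dots> = g S mod int p" using g(2) S by (simp add: cong_def)
      also have "\<dots> = (\<Sum>T\<in>?A. c T * of_bool (T \<subseteq> S)) mod int p"
        using c[of S] S G by auto
      also have "\<dots> = (\<Sum>T\<in>?A. (c T * of_bool (T \<subseteq> S)) mod int p) mod int p"
        by (simp add: mod_sum_eq)
      also have "\<dots> = (\<Sum>T\<in>?A. (?c T * of_bool (T \<subseteq> S)) mod int p) mod int p"
        by (rule arg_cong[where f = "\<lambda>x. x mod int p"], rule sum.cong[OF refl], rule reduce)
      also have "\<dots> = ev ?c S" using S unfolding ev_def by (simp add: mod_sum_eq)
      finally show ?thesis .
    qed
    then have "f = ev ?c" using f unfolding ev_def
      by (intro ext) (auto simp: PiE_def extensional_def)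
    moreover have "?c \<in> ?A \<rightarrow>\<^sub>E ?V" using assms(1) by auto
    ultimately show "f \<in> ev ` (?A \<rightarrow>\<^sub>E ?V)" by blast
  qed
  then have "card (G \<rightarrow>\<^sub>E ?V) \<le> card (?A \<rightarrow>\<^sub>E ?V)"
    by (intro surj_card_le finite_PiE) auto
  then have "p ^ card G \<le> p ^ card ?A" by (simp add: card_PiE finG)
  then show ?thesis using assms(1) by simp
qed

text \<open>In the coordinates \<open>y\<^sub>i = 1 - 2 x\<^sub>i\<close> parity is the product of all \<open>y\<^sub>i\<close>, so on \<open>G\<close> a monomial of
  degree above \<open>n / 2\<close> is \<open>1 - 2 P\<close> times the complementary monomial.\<close>

lemma parity_span:
  fixes p :: nat
  assumes p: "odd p" and P: "P \<in> lowdeg (2 * m) e"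
    and G: "G \<subseteq> Pow {..<2 * m}" "\<And>S. S \<in> G \<Longrightarrow> [P S = of_bool (odd (card S))] (mod int p)"
  shows "\<exists>g \<in> lowdeg (2 * m) (m + e). \<forall>S \<in> G. [f S = g S] (mod int p)"
proof -
  let ?n = "2 * m"
  define y :: "nat \<Rightarrow> nat set \<Rightarrow> int" where "y i S = 1 - 2 * of_bool (i \<in> S)" for i S
  define Y where "Y T S = (\<Prod>i\<in>T. y i S)" for T S
  \<comment> \<open>The inverse of 2 modulo the odd number \<open>p\<close>.\<close>
  define h where "h = (int p + 1) div 2"
  \<comment> \<open>Fourier inversion on the cube, with the \<open>Y T\<close> as characters and
    \<open>h ^ ?n\<close> as the normalising factor; characters of degree above \<open>m\<close> are
    replaced by their substitutes of low degree.\<close>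
  define g where "g S = (\<Sum>a\<in>Pow {..<?n}. \<Sum>T\<in>Pow {..<?n}. (h ^ ?n * f a * Y T a) *
    (if card T \<le> m then Y T S else (1 - 2 * P S) * Y ({..<?n} - T) S))" for S
  have yy: "y i S * y i S = 1" for i S unfolding y_def by simp
  have deg_y: "y i \<in> lowdeg ?n 1" if "i < ?n" for i
    unfolding y_def[abs_def] using that by (intro lowdeg_diff lowdeg_cmult lowdeg_coord lowdeg_const) auto
  have deg_Y: "Y T \<in> lowdeg ?n (card T)" if "T \<subseteq> {..<?n}" for T
    using lowdeg_prod[of T y ?n 1] deg_y that unfolding Y_def[abs_def] by auto
  have "g \<in> lowdeg ?n (m + e)"
    unfolding g_def[abs_def]
  proof (intro lowdeg_sum lowdeg_cmult)
    fix T assume T: "T \<in> Pow {..<?n}"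
    show "(\<lambda>S. if card T \<le> m then Y T S else (1 - 2 * P S) * Y ({..<?n} - T) S) \<in> lowdeg ?n (m + e)"
    proof (cases "card T \<le> m")
      case True
      then show ?thesis using lowdeg_mono[OF deg_Y] T by simp
    next
      case False
      then have "card ({..<?n} - T) \<le> m" using T by (subst card_Diff_subset) (auto intro: finite_subset)
      then have "Y ({..<?n} - T) \<in> lowdeg ?n m" by (intro lowdeg_mono[OF deg_Y]) auto
      moreover have "(\<lambda>S. 1 - 2 * P S) \<in> lowdeg ?n e"
        by (intro lowdeg_diff lowdeg_cmult lowdeg_const P)
      ultimately show ?thesis using False lowdeg_mult[of "\<lambda>S. 1 - 2 * P S" ?n e _ m]
        by (simp add: add.commute)
    qed
  qed
  moreover have "[f S = g S] (mod int p)" if S: "S \<in> G" for S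
  proof -
    have Sn: "S \<subseteq> {..<?n}" using S G by auto
    then have finS: "finite S" by (rule finite_subset) simp
    have "Y {..<?n} S = (\<Prod>i\<in>{..<?n}. if i \<in> S then -1 else 1)"
      unfolding Y_def y_def by (intro prod.cong) auto
    also have "\<dots> = (-1) ^ card S"
      using Sn by (subst prod.If_cases) (auto simp: Int_absorb1 Int_absorb2)
    also have "\<dots> = 1 - 2 * of_bool (odd (card S))" by (auto simp: uminus_power_if)
    finally have "[1 - 2 * P S = Y {..<?n} S] (mod int p)"
      using G(2)[OF S] by (simp add: cong_diff cong_scalar_left)
    \<comment> \<open>The square of every \<open>y i\<close> is 1, so the coordinates outside
      \<open>T\<close> cancel.\<close>
    moreover have "Y {..<?n} S * Y ({..<?n} - T) S = Y T S" if "T \<subseteq> {..<?n}" for T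
    proof -
      have "Y {..<?n} S = Y ({..<?n} - T) S * Y T S"
        unfolding Y_def using that by (intro prod.subset_diff) auto
      moreover have "Y ({..<?n} - T) S * Y ({..<?n} - T) S = 1"
        unfolding Y_def by (simp add: yy flip: prod.distrib)
      ultimately show ?thesis by (simp add: mult.commute mult.left_commute)
    qed
    ultimately have "[(1 - 2 * P S) * Y ({..<?n} - T) S = Y T S] (mod int p)" if "T \<subseteq> {..<?n}" for T
      using that by (metis cong_scalar_right)
    then have "[g S = (\<Sum>a\<in>Pow {..<?n}. \<Sum>T\<in>Pow {..<?n}. (h ^ ?n * f a * Y T a) * Y T S)] (mod int p)"
      unfolding g_def by (intro cong_sum cong_scalar_left) auto
    also have "(\<Sum>a\<in>Pow {..<?n}. \<Sum>T\<in>Pow {..<?n}. (h ^ ?n * f a * Y T a) * Y T S) =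
        h ^ ?n * (\<Sum>a\<in>Pow {..<?n}. f a * (\<Sum>T\<in>Pow {..<?n}. Y T a * Y T S))"
      by (simp add: sum_distrib_left mult.assoc)
    also have "\<dots> = h ^ ?n * (\<Sum>a\<in>Pow {..<?n}. if a = S then f S * 2 ^ ?n else 0)"
    proof -
      have "f a * (\<Sum>T\<in>Pow {..<?n}. Y T a * Y T S) = (if a = S then f S * 2 ^ ?n else 0)"
        if a: "a \<in> Pow {..<?n}" for a
      proof -
        have "(\<Sum>T\<in>Pow {..<?n}. Y T a * Y T S) =
            (\<Sum>T\<in>Pow {..<?n}. (\<Prod>i\<in>T. y i a * y i S) * (\<Prod>i\<in>{..<?n} - T. 1))"
          unfolding Y_def by (simp add: prod.distrib)
        \<comment> \<open>Orthogonality of characters: each factor is 2 where \<open>a\<close> and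
          \<open>S\<close> agree and 0 where they differ.\<close>
        also have "\<dots> = (\<Prod>i\<in>{..<?n}. y i a * y i S + 1)"
          by (rule prod_add[symmetric]) simp
        also have "\<dots> = (if a = S then 2 ^ ?n else 0)"
        proof (cases "a = S")
          case True
          then show ?thesis by (simp add: yy)
        next
          case False
          then obtain i where "i \<in> a \<longleftrightarrow> i \<notin> S" by blast
          moreover from this have "i < ?n" using a Sn by blast
          ultimately have "y i a * y i S + 1 = 0" "i \<in> {..<?n}" unfolding y_def by auto
          then show ?thesis using False by (subst prod_zero) auto
        qed
        finally show ?thesis by simp
      qed
      then show ?thesis
        by (intro arg_cong[where f = "(*) (h ^ ?n)"] sum.cong refl)
    qed
    also have "\<dots> = (h * 2) ^ ?n * f S"
      using Sn by (subst sum.delta) (auto simp: power_mult_distrib)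
    also have "[\<dots> = 1 ^ ?n * f S] (mod int p)"
    proof -
      have "h * 2 = int p + 1" using p unfolding h_def by (intro dvd_div_mult_self) simp
      then have "[h * 2 = 1] (mod int p)" by (simp add: cong_def)
      then show ?thesis by (intro cong_scalar_right cong_pow)
    qed
    finally show ?thesis by (simp add: cong_sym)
  qed
  ultimately show ?thesis by blast
qed

text \<open>Squaring avoids the square root in the usual bound
  \<open>4 ^ m / sqrt (2 * m + 1)\<close>. The induction rests on
  \<open>(2 * m + 1) * (2 * m + 3) = 4 * (m + 1)\<^sup>2 - 1\<close>.\<close>

lemma central_binomial_sq: "(2 * m choose m)\<^sup>2 * (2 * m + 1) \<le> 16 ^ m"
proof (induction m)
  case (Suc m)
  let ?a = "2 * m choose m" and ?b = "2 * Suc m choose Suc m"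
  have b: "Suc m * ?b = 2 * (2 * m + 1) * ?a"
  proof -
    have "Suc m * ?b = 2 * Suc m * (2 * m + 1 choose m)"
      using Suc_times_binomial_eq[of "2 * m + 1" m] by simp
    moreover have "Suc m * (2 * m + 1 choose m) = (2 * m + 1) * ?a"
      using Suc_times_binomial_eq[of "2 * m" m] binomial_symmetric[of m "2 * m + 1"]
      by (simp add: mult.commute)
    ultimately show ?thesis by (simp add: mult.assoc)
  qed
  have "(Suc m)\<^sup>2 * (?b\<^sup>2 * (2 * Suc m + 1)) = (Suc m * ?b)\<^sup>2 * (2 * m + 3)"
  proof -
    have "2 * Suc m + 1 = 2 * m + 3" by simp
    then show ?thesis by (simp only: power_mult_distrib mult.assoc)
  qed
  also have "\<dots> = 4 * ((2 * m + 1) * (2 * m + 3)) * (?a\<^sup>2 * (2 * m + 1))"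
    unfolding b by (simp add: power2_eq_square algebra_simps)
  also have "\<dots> \<le> 4 * (4 * (Suc m)\<^sup>2) * 16 ^ m"
  proof -
    have "(2 * m + 1) * (2 * m + 3) \<le> 4 * (Suc m)\<^sup>2"
      by (simp add: power2_eq_square algebra_simps)
    then show ?thesis by (rule mult_mono[OF mult_left_mono Suc.IH]) simp_all
  qed
  also have "\<dots> = (Suc m)\<^sup>2 * 16 ^ Suc m" by simp
  finally show ?case by simp
qed simp

lemma card_low_subsets:
  "card {T. T \<subseteq> {..<n::nat} \<and> card T \<le> d} = (\<Sum>k\<le>d. n choose k)"
proof -
  have "{T. T \<subseteq> {..<n} \<and> card T \<le> d} = (\<Union>k\<le>d. {T. T \<subseteq> {..<n} \<and> card T = k})" by auto
  also have "card \<dots> = (\<Sum>k\<le>d. card {T. T \<subseteq> {..<n} \<and> card T = k})"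
    by (intro card_UN_disjoint) auto
  finally show ?thesis by (simp add: n_subsets)
qed

text \<open>By symmetry the coefficients below the middle make up at most half of the row; each of
  the \<open>e + 1\<close> others is at most the central one.\<close>

lemma sum_choose_le:
  "2 * (\<Sum>k\<le>m + e. 2 * m choose k) \<le> 4 ^ m + 2 * ((e + 1) * (2 * m choose m))"
proof -
  have "(\<Sum>k<m. 2 * m choose k) = (\<Sum>k\<in>{m<..2 * m}. 2 * m choose k)"
    by (rule sum.reindex_bij_witness[of _ "\<lambda>k. 2 * m - k" "\<lambda>k. 2 * m - k"])
       (auto simp: binomial_symmetric[symmetric])
  then have "2 * (\<Sum>k<m. 2 * m choose k) =
      (\<Sum>k\<in>{..<m} \<union> {m<..2 * m}. 2 * m choose k)"
    by (subst sum.union_disjoint) auto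
  also have "\<dots> \<le> (\<Sum>k\<le>2 * m. 2 * m choose k)" by (intro sum_mono2) auto
  also have "\<dots> = 4 ^ m" by (simp add: choose_row_sum power_mult)
  finally have 1: "2 * (\<Sum>k<m. 2 * m choose k) \<le> 4 ^ m" .
  have "(\<Sum>k\<in>{m..m + e}. 2 * m choose k) \<le> (\<Sum>k\<in>{m..m + e}. 2 * m choose m)"
    by (intro sum_mono binomial_maximum')
  then have 2: "(\<Sum>k\<in>{m..m + e}. 2 * m choose k) \<le> (e + 1) * (2 * m choose m)" by simp
  have "{..m + e} = {..<m} \<union> {m..m + e}" by auto
  then have "(\<Sum>k\<le>m + e. 2 * m choose k) =
      (\<Sum>k<m. 2 * m choose k) + (\<Sum>k\<in>{m..m + e}. 2 * m choose k)"
    by (simp add: sum.union_disjoint ivl_disj_int)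
  then show ?thesis using 1 2 by simp
qed

text \<open>With an error of at most a quarter, \<open>?G\<close> would contain three quarters of
  the cube. The monomials of degree at most \<open>m + e\<close> number at most half of
  \<open>4 ^ m\<close> plus \<open>e + 1\<close> central coefficients, and the bound on
  \<open>e\<close> keeps the latter below the missing quarter.\<close>

theorem parity_not_approximable:
  fixes p :: nat
  assumes p: "prime p" "odd p" and P: "P \<in> lowdeg (2 * m) e"
    and e: "16 * (e + 1)\<^sup>2 < 2 * m + 1"
  shows "4 ^ m < 4 * card {S \<in> Pow {..<2 * m}. \<not> [P S = of_bool (odd (card S))] (mod int p)}"
proof (rule ccontr)
  let ?B = "{S \<in> Pow {..<2 * m}. \<not> [P S = of_bool (odd (card S))] (mod int p)}"
  let ?G = "Pow {..<2 * m} - ?B"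
  let ?c = "2 * m choose m"
  assume "\<not> ?thesis"
  then have B: "4 * card ?B \<le> 4 ^ m" by simp
  have "card ?G \<le> card {T. T \<subseteq> {..<2 * m} \<and> card T \<le> m + e}"
  proof (rule card_le_of_lowdeg_span)
    show "1 < p" using p(1) by (rule prime_gt_1_nat)
    show "\<exists>g \<in> lowdeg (2 * m) (m + e). \<forall>S \<in> ?G. [f S = g S] (mod int p)" for f
      by (rule parity_span[OF p(2) P]) auto
  qed auto
  then have "2 * card ?G \<le> 4 ^ m + 2 * ((e + 1) * ?c)"
    using sum_choose_le[of m e] by (simp only: card_low_subsets)
  moreover have "card ?G + card ?B = 4 ^ m"
  proof -
    have "card ?G = card (Pow {..<2 * m}) - card ?B" by (intro card_Diff_subset) auto
    moreover have "card ?B \<le> card (Pow {..<2 * m})" by (intro card_mono) auto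
    ultimately show ?thesis by (simp add: card_Pow power_mult)
  qed
  ultimately have 1: "4 ^ m \<le> 4 * ((e + 1) * ?c)" using B by linarith
  have "16 ^ m * (2 * m + 1) \<le> (4 * ((e + 1) * ?c))\<^sup>2 * (2 * m + 1)"
  proof (rule mult_right_mono)
    have "(16 :: nat) ^ m = (4 ^ m)\<^sup>2" by (simp add: power2_eq_square flip: power_mult_distrib)
    also have "\<dots> \<le> (4 * ((e + 1) * ?c))\<^sup>2" using 1 by (rule power_mono) simp
    finally show "16 ^ m \<le> (4 * ((e + 1) * ?c))\<^sup>2" .
  qed simp
  also have "\<dots> = 16 * (e + 1)\<^sup>2 * (?c\<^sup>2 * (2 * m + 1))"
    by (simp add: power_mult_distrib del: One_nat_def)
  also have "\<dots> \<le> 16 * (e + 1)\<^sup>2 * 16 ^ m" using central_binomial_sq by (intro mult_left_mono) auto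
  finally have "16 ^ m * (2 * m + 1) \<le> 16 ^ m * (16 * (e + 1)\<^sup>2)" by (simp only: mult.commute)
  then have "2 * m + 1 \<le> 16 * (e + 1)\<^sup>2" by (subst (asm) mult_le_cancel1) simp
  then show False using e by linarith
qed

section \<open>Approximation of circuits\<close>

lemma int_fermat:
  fixes p :: nat
  assumes "prime p" "\<not> int p dvd a"
  shows "[a ^ (p - 1) = 1] (mod int p)"
proof -
  define b where "b = nat (a mod int p)"
  have b: "int b = a mod int p" using assms(1) prime_gt_0_nat unfolding b_def by simp
  have "\<not> p dvd b"
  proof
    assume "p dvd b"
    then have "int p dvd a mod int p" by (simp flip: b)
    then show False using assms(2) by (simp add: dvd_mod_iff)
  qed
  then have "[int (b ^ (p - 1)) = int 1] (mod int p)"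
    using fermat_theorem[OF assms(1)] by (simp only: cong_int_iff)
  then have "[int b ^ (p - 1) = 1] (mod int p)" by simp
  moreover have "[a ^ (p - 1) = int b ^ (p - 1)] (mod int p)"
    by (intro cong_pow) (simp add: b cong_def)
  ultimately show ?thesis using cong_trans by blast
qed

text \<open>Toggling \<open>i\<close> changes a subsum by \<open>f i\<close> up to sign, so it maps
  the vanishing subsums injectively to nonvanishing ones.\<close>

lemma card_vanishing_subsums_le:
  fixes f :: "'i \<Rightarrow> int"
  assumes "finite I" "i \<in> I" "\<not> m dvd f i"
  shows "2 * card {R \<in> Pow I. m dvd sum f R} \<le> 2 ^ card I"
proof -
  let ?Z = "{R \<in> Pow I. m dvd sum f R}"
  let ?t = "\<lambda>R. if i \<in> R then R - {i} else insert i R"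
  have finZ: "finite ?Z" using assms(1) by simp
  have inj: "inj_on ?t ?Z"
    by (rule inj_on_inverseI[of _ ?t]) auto
  have "?t ` ?Z \<subseteq> Pow I - ?Z"
  proof
    fix U assume "U \<in> ?t ` ?Z"
    then obtain R where R: "R \<subseteq> I" "m dvd sum f R" "U = ?t R" by blast
    have finR: "finite R" using R(1) assms(1) finite_subset by blast
    have "sum f U = sum f R - f i \<or> sum f U = sum f R + f i"
      using R(3) finR by (cases "i \<in> R") (simp_all add: sum_diff1)
    then have "\<not> m dvd sum f U"
      using R(2) assms(3) by (metis dvd_add_right_iff dvd_diff_right_iff)
    then show "U \<in> Pow I - ?Z" using R(1,3) assms(2) by auto
  qed
  then have "card (?t ` ?Z) \<le> card (Pow I - ?Z)"
    using assms(1) by (intro card_mono) auto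
  then have "card ?Z \<le> card (Pow I - ?Z)" by (simp only: card_image[OF inj])
  also have "\<dots> = card (Pow I) - card ?Z" using finZ by (intro card_Diff_subset) auto
  finally show ?thesis using assms(1) by (simp add: card_Pow)
qed

lemma card_filter:
  assumes "finite A"
  shows "card {x \<in> A. P x} = (\<Sum>x\<in>A. if P x then 1 else 0)"
  using assms by (simp flip: sum.inter_filter)

text \<open>Averaging: for each point of \<open>B\<close> at most half of the subsets
  \<open>R\<close> give a vanishing subsum, so by double counting some fixed \<open>R\<close> does
  so on at most half of \<open>B\<close>.\<close>

lemma halving_subset:
  fixes f :: "'i \<Rightarrow> 'x \<Rightarrow> int"
  assumes "finite I" "finite B" and B: "\<And>x. x \<in> B \<Longrightarrow> \<exists>i\<in>I. \<not> m dvd f i x"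
  shows "\<exists>R\<subseteq>I. 2 * card {x \<in> B. m dvd (\<Sum>i\<in>R. f i x)} \<le> card B"
proof (rule ccontr)
  assume "\<not> ?thesis"
  then have "card B + 1 \<le> 2 * card {x \<in> B. m dvd (\<Sum>i\<in>R. f i x)}" if "R \<in> Pow I" for R
    using that by (simp add: Suc_le_eq not_le)
  then have "(\<Sum>R\<in>Pow I. card B + 1) \<le> (\<Sum>R\<in>Pow I. 2 * card {x \<in> B. m dvd (\<Sum>i\<in>R. f i x)})"
    by (rule sum_mono)
  also have "\<dots> = 2 * (\<Sum>R\<in>Pow I. \<Sum>x\<in>B. if m dvd (\<Sum>i\<in>R. f i x) then 1 else 0)"
    by (simp only: card_filter[OF assms(2)] sum_distrib_left)
  also have "\<dots> = 2 * (\<Sum>x\<in>B. \<Sum>R\<in>Pow I. if m dvd (\<Sum>i\<in>R. f i x) then 1 else 0)"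
    by (subst sum.swap) (rule refl)
  also have "\<dots> = (\<Sum>x\<in>B. 2 * card {R \<in> Pow I. m dvd (\<Sum>i\<in>R. f i x)})"
    using assms(1) by (simp only: card_filter finite_Pow_iff sum_distrib_left)
  also have "\<dots> \<le> (\<Sum>x\<in>B. 2 ^ card I)"
  proof (rule sum_mono)
    fix x assume "x \<in> B"
    then obtain i where "i \<in> I" "\<not> m dvd f i x" using B by blast
    then show "2 * card {R \<in> Pow I. m dvd (\<Sum>i\<in>R. f i x)} \<le> 2 ^ card I"
      using card_vanishing_subsums_le[of I i m "\<lambda>i. f i x"] assms(1) by simp
  qed
  finally show False using assms(1) by (simp add: card_Pow)
qed

text \<open>Each further factor \<open>1 - (\<Sum>i\<in>R. f i S) ^ (p - 1)\<close>, for a suitable subset \<open>R\<close>, halves the set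
  of points where the product is wrongly nonzero.\<close>

lemma nor_approx:
  fixes p :: nat
  assumes p: "prime p" and I: "finite I" and f: "\<And>i. i \<in> I \<Longrightarrow> f i \<in> lowdeg n d"
  shows "\<exists>Q \<in> lowdeg n (t * ((p - 1) * d)).
    (\<forall>S. (\<forall>i\<in>I. int p dvd f i S) \<longrightarrow> [Q S = 1] (mod int p)) \<and>
    card {S \<in> Pow {..<n}. (\<exists>i\<in>I. \<not> int p dvd f i S) \<and> \<not> int p dvd Q S} * 2 ^ t \<le> 2 ^ n"
proof (induction t)
  case 0
  have "card {S \<in> Pow {..<n}. (\<exists>i\<in>I. \<not> int p dvd f i S) \<and> \<not> int p dvd 1} \<le> card (Pow {..<n})"
    by (intro card_mono) auto
  then show ?case by (intro bexI[of _ "\<lambda>_. 1"]) (auto simp: card_Pow)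
next
  case (Suc t)
  then obtain Q where Q: "Q \<in> lowdeg n (t * ((p - 1) * d))"
    and Q1: "\<And>S. \<forall>i\<in>I. int p dvd f i S \<Longrightarrow> [Q S = 1] (mod int p)"
    and Qc: "card {S \<in> Pow {..<n}. (\<exists>i\<in>I. \<not> int p dvd f i S) \<and> \<not> int p dvd Q S} * 2 ^ t \<le> 2 ^ n"
      (is "card ?B * _ \<le> _")
    by blast
  have "\<exists>R\<subseteq>I. 2 * card {S \<in> ?B. int p dvd (\<Sum>i\<in>R. f i S)} \<le> card ?B"
    by (rule halving_subset[OF I]) auto
  then obtain R where R: "R \<subseteq> I" "2 * card {S \<in> ?B. int p dvd (\<Sum>i\<in>R. f i S)} \<le> card ?B"
    by blast
  define Q' where "Q' = (\<lambda>S. Q S * (1 - (\<Sum>i\<in>R. f i S) ^ (p - 1)))"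
  have "Q' \<in> lowdeg n (t * ((p - 1) * d) + (p - 1) * d)"
    unfolding Q'_def using R(1) f
    by (intro lowdeg_mult[OF Q] lowdeg_diff lowdeg_const lowdeg_power lowdeg_sum) auto
  then have "Q' \<in> lowdeg n (Suc t * ((p - 1) * d))" by (simp add: add.commute)
  moreover have "[Q' S = 1] (mod int p)" if "\<forall>i\<in>I. int p dvd f i S" for S
  proof -
    have "int p dvd (\<Sum>i\<in>R. f i S)" using that R(1) by (intro dvd_sum) auto
    then have "int p dvd (\<Sum>i\<in>R. f i S) ^ (p - 1)"
      using prime_gt_1_nat[OF p] by (intro dvd_trans[OF _ dvd_power[of "p - 1"]]) auto
    then have "[Q' S = 1 * (1 - 0)] (mod int p)"
      unfolding Q'_def using Q1[OF that] by (intro cong_mult cong_diff) (auto simp: cong_0_iff)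
    then show ?thesis by simp
  qed
  moreover have "card {S \<in> Pow {..<n}. (\<exists>i\<in>I. \<not> int p dvd f i S) \<and> \<not> int p dvd Q' S} * 2 ^ Suc t \<le> 2 ^ n"
    (is "card ?B' * _ \<le> _")
  proof -
    \<comment> \<open>By Fermat the new factor is zero modulo \<open>p\<close> wherever the subsum
      is not, so an error survives only where the subsum vanishes.\<close>
    have "?B' \<subseteq> {S \<in> ?B. int p dvd (\<Sum>i\<in>R. f i S)}"
    proof
      fix S assume S: "S \<in> ?B'"
      then have "\<not> int p dvd Q S" "\<not> int p dvd 1 - (\<Sum>i\<in>R. f i S) ^ (p - 1)"
        unfolding Q'_def by auto
      moreover have "int p dvd 1 - (\<Sum>i\<in>R. f i S) ^ (p - 1)" if "\<not> int p dvd (\<Sum>i\<in>R. f i S)"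
        using int_fermat[OF p that] by (simp add: cong_iff_dvd_diff dvd_diff_commute)
      ultimately show "S \<in> {S \<in> ?B. int p dvd (\<Sum>i\<in>R. f i S)}" using S by auto
    qed
    then have "card ?B' \<le> card {S \<in> ?B. int p dvd (\<Sum>i\<in>R. f i S)}" by (intro card_mono) auto
    then have "2 * card ?B' \<le> card ?B" using R(2) by linarith
    then have "2 * card ?B' * 2 ^ t \<le> card ?B * 2 ^ t" by (rule mult_right_mono) simp
    also note Qc
    finally show ?thesis by (simp only: power_Suc mult.assoc mult.left_commute[of "card ?B'"])
  qed
  ultimately show ?case by blast
qed

section \<open>Divisibility by a prime power as a polynomial modulo the prime\<close>

lemma prime_dvd_prime_power_choose:
  fixes p :: nat
  assumes "prime p" "0 < i" "i < p ^ a"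
  shows "p dvd (p ^ a choose i)"
proof (rule ccontr)
  assume "\<not> ?thesis"
  then have "coprime (p ^ a) (p ^ a choose i)"
    using assms(1) by (simp add: prime_imp_coprime)
  \<comment> \<open>Absorption: with \<open>q = p ^ a\<close>, the product equals \<open>q\<close>
    times \<open>q - 1 choose i - 1\<close>. If \<open>p\<close> did not divide the coefficient,
    \<open>q\<close> would divide the smaller positive number \<open>i\<close>.\<close>
  moreover have "p ^ a dvd i * (p ^ a choose i)"
    using times_binomial_minus1_eq[OF assms(2), of "p ^ a"] by simp
  ultimately have "p ^ a dvd i" by (simp add: coprime_dvd_mult_left_iff)
  then show False using assms(2,3) by (auto dest: dvd_imp_le)
qed

text \<open>In Vandermonde's convolution every term but the one for \<open>k = 0\<close> contains a
  coefficient divisible by \<open>p\<close>. Thus \<open>N choose j\<close> has period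
  \<open>p ^ a\<close> in \<open>N\<close>.\<close>

lemma choose_add_prime_power_cong:
  fixes p :: nat
  assumes "prime p" "j < p ^ a"
  shows "[N + p ^ a choose j = N choose j] (mod p)"
proof -
  have "(N + p ^ a choose j) = (\<Sum>k\<le>j. (p ^ a choose k) * (N choose (j - k)))"
    by (simp add: vandermonde add.commute)
  also have "[\<dots> = (\<Sum>k\<le>j. if k = 0 then N choose j else 0)] (mod p)"
    using prime_dvd_prime_power_choose[OF assms(1), of _ a] assms(2)
    by (intro cong_sum) (auto simp: cong_0_iff)
  finally show ?thesis by simp
qed

text \<open>By periodicity only \<open>N < p ^ a\<close> has to be examined. There the sum runs over
  the whole binomial row, whose alternating sum is 0 unless \<open>N = 0\<close>.\<close>

lemma alternating_sum_choose_cong: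
  fixes p :: nat
  assumes "prime p"
  shows "[(\<Sum>j<p ^ a. (-1) ^ j * int (N choose j)) = of_bool (p ^ a dvd N)] (mod int p)"
proof (induction N rule: less_induct)
  case (less N)
  let ?s = "\<lambda>N. (\<Sum>j<p ^ a. (-1) ^ j * int (N choose j))"
  have q: "0 < p ^ a" using prime_gt_0_nat[OF assms] by simp
  consider "N = 0" | "0 < N" "N < p ^ a" | "p ^ a \<le> N" by linarith
  then show ?case
  proof cases
    case 1
    have "?s 0 = (\<Sum>j<p ^ a. if j = 0 then 1 else 0)" by (intro sum.cong) auto
    then show ?thesis using 1 q by simp
  next
    case 2
    have "?s N = (\<Sum>j\<le>N. (-1) ^ j * int (N choose j))"
      using 2 by (intro sum.mono_neutral_right) auto
    also have "\<dots> = 0" using choose_alternating_sum[OF 2(1), where 'a = int] by simp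
    finally show ?thesis using 2 by (auto dest: dvd_imp_le)
  next
    case 3
    define M where "M = N - p ^ a"
    have N: "N = M + p ^ a" using 3 unfolding M_def by simp
    have "[?s N = ?s M] (mod int p)"
      unfolding N
    proof (intro cong_sum cong_scalar_left)
      fix j assume "j \<in> {..<p ^ a}"
      then show "[int (M + p ^ a choose j) = int (M choose j)] (mod int p)"
        using choose_add_prime_power_cong[OF assms] by (simp add: cong_int_iff)
    qed
    also have "[?s M = of_bool (p ^ a dvd M)] (mod int p)" using less[of M] N q by simp
    also have "p ^ a dvd M \<longleftrightarrow> p ^ a dvd N" unfolding N by simp
    finally show ?thesis .
  qed
qed

text \<open>The number of \<open>j\<close>-element sets of true inputs is the elementary symmetric
  polynomial of degree \<open>j\<close> in the inputs, which turns the alternating binomial sum into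
  \<open>Q\<close>. There is no exceptional set.\<close>

lemma mod_gate_poly:
  fixes p :: nat
  assumes "prime p" and I: "finite I" and f: "\<And>i. i \<in> I \<Longrightarrow> f i \<in> lowdeg n d"
  obtains Q where "Q \<in> lowdeg n (p ^ a * d)"
    "\<forall>S v. (\<forall>i\<in>I. [f i S = of_bool (v i)] (mod int p)) \<longrightarrow>
      [Q S = of_bool (p ^ a dvd card {i \<in> I. v i})] (mod int p)"
proof -
  let ?J = "{J. J \<subseteq> I \<and> card J < p ^ a}"
  define Q where "Q = (\<lambda>S. \<Sum>J\<in>?J. (-1) ^ card J * (\<Prod>i\<in>J. f i S))"
  have "Q \<in> lowdeg n (p ^ a * d)"
    unfolding Q_def
  proof (intro lowdeg_sum lowdeg_cmult)
    fix J assume J: "J \<in> ?J"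
    then have "(\<lambda>S. \<Prod>i\<in>J. f i S) \<in> lowdeg n (card J * d)" using f by (intro lowdeg_prod) auto
    then show "(\<lambda>S. \<Prod>i\<in>J. f i S) \<in> lowdeg n (p ^ a * d)"
      by (rule lowdeg_mono) (use J in auto)
  qed
  moreover have "[Q S = of_bool (p ^ a dvd card {i \<in> I. v i})] (mod int p)"
    if v: "\<forall>i\<in>I. [f i S = of_bool (v i)] (mod int p)" for S v
  proof -
    let ?T = "{i \<in> I. v i}"
    have "[Q S = (\<Sum>J\<in>?J. (-1) ^ card J * (\<Prod>i\<in>J. of_bool (v i)))] (mod int p)"
      unfolding Q_def by (intro cong_sum cong_scalar_left cong_prod v[rule_format]) auto
    also have "(\<Sum>J\<in>?J. (-1) ^ card J * (\<Prod>i\<in>J. of_bool (v i))) =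
        (\<Sum>J | J \<subseteq> ?T \<and> card J < p ^ a. (-1) ^ card J :: int)"
    proof (rule sum.mono_neutral_cong_right)
      show "finite ?J" using I by simp
      show "\<forall>J\<in>?J - {J. J \<subseteq> ?T \<and> card J < p ^ a}.
          (-1) ^ card J * (\<Prod>i\<in>J. of_bool (v i)) = (0 :: int)"
      proof
        fix J assume "J \<in> ?J - {J. J \<subseteq> ?T \<and> card J < p ^ a}"
        then have "finite J" "\<exists>i\<in>J. \<not> v i" using finite_subset[OF _ I] by auto
        then show "(-1) ^ card J * (\<Prod>i\<in>J. of_bool (v i)) = (0 :: int)"
          by (subst prod_zero) auto
      qed
      show "(-1) ^ card J * (\<Prod>i\<in>J. of_bool (v i)) = ((-1) ^ card J :: int)"
        if "J \<in> {J. J \<subseteq> ?T \<and> card J < p ^ a}" for J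
        using that by (subst prod.neutral) auto
    qed auto
    also have "\<dots> = (\<Sum>j<p ^ a. \<Sum>J | J \<in> {J. J \<subseteq> ?T \<and> card J < p ^ a} \<and> card J = j. (-1) ^ card J)"
      using I by (intro sum.group[symmetric]) auto
    also have "\<dots> = (\<Sum>j<p ^ a. (-1) ^ j * int (card ?T choose j))"
    proof (rule sum.cong[OF refl])
      fix j assume "j \<in> {..<p ^ a}"
      then have "{J. J \<in> {J. J \<subseteq> ?T \<and> card J < p ^ a} \<and> card J = j} = {J. J \<subseteq> ?T \<and> card J = j}"
        by auto
      then show "(\<Sum>J | J \<in> {J. J \<subseteq> ?T \<and> card J < p ^ a} \<and> card J = j. (-1) ^ card J) =
          (-1) ^ j * int (card ?T choose j)"
        using n_subsets[of ?T j] I by simp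
    qed
    also have "[\<dots> = of_bool (p ^ a dvd card ?T)] (mod int p)"
      by (rule alternating_sum_choose_cong[OF assms(1)])
    finally show ?thesis .
  qed
  ultimately show thesis using that by blast
qed

text \<open>The exceptional set depends on the polynomials alone and is fixed before
  \<open>v\<close>. In a circuit the \<open>f i\<close> represent the wires only outside earlier
  exceptional sets, and this order of quantifiers lets the new set simply be added to those.\<close>

lemma or_approx:
  fixes p :: nat
  assumes p: "prime p" and I: "finite I" and f: "\<And>i. i \<in> I \<Longrightarrow> f i \<in> lowdeg n d"
  obtains Q E where "Q \<in> lowdeg n (t * ((p - 1) * d))"
    "E \<subseteq> Pow {..<n}" "card E * 2 ^ t \<le> 2 ^ n"
    "\<forall>S \<in> Pow {..<n} - E. \<forall>v. (\<forall>i\<in>I. [f i S = of_bool (v i)] (mod int p)) \<longrightarrow>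
      [Q S = of_bool (\<exists>i\<in>I. v i)] (mod int p)"
proof -
  obtain Q where Q: "Q \<in> lowdeg n (t * ((p - 1) * d))"
    and Q1: "\<And>S. \<forall>i\<in>I. int p dvd f i S \<Longrightarrow> [Q S = 1] (mod int p)"
    and Qc: "card {S \<in> Pow {..<n}. (\<exists>i\<in>I. \<not> int p dvd f i S) \<and> \<not> int p dvd Q S} * 2 ^ t \<le> 2 ^ n"
      (is "card ?B * _ \<le> _")
    using nor_approx[where f = f and t = t, OF p I f] by blast
  have approx: "[1 - Q S = of_bool (\<exists>i\<in>I. v i)] (mod int p)"
    if S: "S \<in> Pow {..<n} - ?B"
      and v: "\<forall>i\<in>I. [f i S = of_bool (v i)] (mod int p)" for S v
  proof -
    have dvd: "int p dvd f i S \<longleftrightarrow> \<not> v i" if "i \<in> I" for i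
    proof -
      have "\<not> int p dvd 1" using prime_gt_1_nat[OF p] by simp
      moreover have "int p dvd f i S \<longleftrightarrow> int p dvd of_bool (v i)"
        using v[rule_format, OF that] by (rule cong_dvd_iff)
      ultimately show ?thesis by (cases "v i") auto
    qed
    show ?thesis
    proof (cases "\<exists>i\<in>I. v i")
      case True
      then have "int p dvd Q S" using S dvd by auto
      then show ?thesis using True by (simp add: cong_iff_dvd_diff)
    next
      case False
      then have "[Q S = 1] (mod int p)" using dvd by (intro Q1) auto
      then show ?thesis using False by (simp add: cong_iff_dvd_diff dvd_diff_commute)
    qed
  qed
  show thesis
  proof (rule that)
    show "(\<lambda>S. 1 - Q S) \<in> lowdeg n (t * ((p - 1) * d))" by (intro lowdeg_diff lowdeg_const Q)
    show "?B \<subseteq> Pow {..<n}" by blast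
  qed (use Qc approx in blast)+
qed

lemma gate_approx:
  fixes p :: nat
  assumes p: "prime p" and D: "1 \<le> D" "t * (p - 1) \<le> D" "p ^ a \<le> D"
    and F: "\<And>i. i \<in> set (gate_inputs g) \<Longrightarrow> F i \<in> lowdeg n d"
  obtains Q E where "Q \<in> lowdeg n (D * d)" "E \<subseteq> Pow {..<n}" "card E * 2 ^ t \<le> 2 ^ n"
    "\<forall>S \<in> Pow {..<n} - E. \<forall>vs.
      (\<forall>i \<in> set (gate_inputs g). [F i S = of_bool (vs ! i)] (mod int p)) \<longrightarrow>
      [Q S = of_bool (gate_value (p ^ a) vs g)] (mod int p)"
proof -
  have le: "t * ((p - 1) * d) \<le> D * d" using mult_right_mono[OF D(2), of d] by (simp add: mult.assoc)
  have neg: "[1 - x = of_bool (\<not> b)] (mod int p)" if "[x = of_bool b] (mod int p)" for x b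
    using cong_diff[OF cong_refl[of 1] that] by (cases b) auto
  show thesis
  proof (cases g)
    case (Or_Gate js)
    have deg: "F i \<in> lowdeg n d" if "i \<in> set js" for i using F that Or_Gate by simp
    obtain Q E where Q: "Q \<in> lowdeg n (t * ((p - 1) * d))"
      and E: "E \<subseteq> Pow {..<n}" "card E * 2 ^ t \<le> 2 ^ n"
      and QE: "\<forall>S \<in> Pow {..<n} - E. \<forall>v. (\<forall>i\<in>set js. [F i S = of_bool (v i)] (mod int p)) \<longrightarrow>
        [Q S = of_bool (\<exists>i\<in>set js. v i)] (mod int p)"
      by (rule or_approx[where I = "set js" and f = F and t = t, OF p finite_set]) (rule deg, assumption, rule that)
    show thesis
    proof (rule that[OF lowdeg_mono[OF Q le] E], intro ballI allI impI)
      fix S vs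
      assume "S \<in> Pow {..<n} - E"
        "\<forall>i \<in> set (gate_inputs g). [F i S = of_bool (vs ! i)] (mod int p)"
      then show "[Q S = of_bool (gate_value (p ^ a) vs g)] (mod int p)"
        using QE[rule_format, of S "\<lambda>i. vs ! i"] Or_Gate by simp
    qed
  next
    \<comment> \<open>De Morgan: the disjunction of the negated wires is approximated and then
      negated.\<close>
    case (And_Gate js)
    have deg: "(\<lambda>S. 1 - F i S) \<in> lowdeg n d" if "i \<in> set js" for i
      using F[of i] that And_Gate by (intro lowdeg_diff lowdeg_const) auto
    obtain Q E where Q: "Q \<in> lowdeg n (t * ((p - 1) * d))"
      and E: "E \<subseteq> Pow {..<n}" "card E * 2 ^ t \<le> 2 ^ n"
      and QE: "\<forall>S \<in> Pow {..<n} - E. \<forall>v. (\<forall>i\<in>set js. [1 - F i S = of_bool (v i)] (mod int p)) \<longrightarrow>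
        [Q S = of_bool (\<exists>i\<in>set js. v i)] (mod int p)"
      by (rule or_approx[where I = "set js" and f = "\<lambda>i S. 1 - F i S" and t = t, OF p finite_set])
        (rule deg, assumption, rule that)
    show thesis
    proof (rule that[OF lowdeg_diff[OF lowdeg_const[of 1] lowdeg_mono[OF Q le]] E], intro ballI allI impI)
      fix S vs
      assume "S \<in> Pow {..<n} - E"
        "\<forall>i \<in> set (gate_inputs g). [F i S = of_bool (vs ! i)] (mod int p)"
      then have "[Q S = of_bool (\<exists>i\<in>set js. \<not> vs ! i)] (mod int p)"
        using And_Gate by (intro QE[rule_format] neg) auto
      then show "[1 - Q S = of_bool (gate_value (p ^ a) vs g)] (mod int p)"
        using neg[of "Q S" "\<exists>i\<in>set js. \<not> vs ! i"] And_Gate by simp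
    qed
  next
    case (Not_Gate i)
    have "F i \<in> lowdeg n d" using F Not_Gate by simp
    then have "F i \<in> lowdeg n (D * d)" by (rule lowdeg_mono) (use D(1) in simp)
    from lowdeg_diff[OF lowdeg_const[of 1] this] show thesis
    proof (rule that[of _ "{}"]; (intro ballI allI impI)?)
      fix S vs
      assume "\<forall>i \<in> set (gate_inputs g). [F i S = of_bool (vs ! i)] (mod int p)"
      then show "[1 - F i S = of_bool (gate_value (p ^ a) vs g)] (mod int p)"
        using neg[of "F i S" "vs ! i"] Not_Gate by simp
    qed simp_all
  next
    case (Mod_Gate js)
    \<comment> \<open>Indexing by positions in \<open>js\<close> rather than by wires counts
      parallel wires with multiplicity.\<close>
    have deg: "F (js ! k) \<in> lowdeg n d" if "k \<in> {..<length js}" for k using F Mod_Gate that by simp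
    obtain Q where Q: "Q \<in> lowdeg n (p ^ a * d)"
      and QE: "\<forall>S v. (\<forall>k\<in>{..<length js}. [F (js ! k) S = of_bool (v k)] (mod int p)) \<longrightarrow>
        [Q S = of_bool (p ^ a dvd card {k \<in> {..<length js}. v k})] (mod int p)"
      by (rule mod_gate_poly[where I = "{..<length js}" and f = "\<lambda>k. F (js ! k)" and a = a, OF p finite_lessThan])
        (rule deg, assumption, rule that)
    have "Q \<in> lowdeg n (D * d)" by (rule lowdeg_mono[OF Q]) (use D(3) in simp)
    from lowdeg_diff[OF lowdeg_const[of 1] this] show thesis
    proof (rule that[of _ "{}"]; (intro ballI allI impI)?)
      fix S vs
      assume vs: "\<forall>i \<in> set (gate_inputs g). [F i S = of_bool (vs ! i)] (mod int p)"
      have "length (filter (\<lambda>i. vs ! i) js) = card {k \<in> {..<length js}. vs ! (js ! k)}"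
        by (simp add: length_filter_conv_card)
      moreover have "[1 - Q S = of_bool (\<not> p ^ a dvd card {k \<in> {..<length js}. vs ! (js ! k)})] (mod int p)"
        using vs Mod_Gate by (intro neg QE[rule_format]) simp
      ultimately show "[1 - Q S = of_bool (gate_value (p ^ a) vs g)] (mod int p)"
        using Mod_Gate by simp
    qed simp_all
  qed
qed

section \<open>Induction along the gates of a circuit\<close>

abbreviation eval_gates :: "nat \<Rightarrow> bool list \<Rightarrow> gate list \<Rightarrow> bool list" where
  "eval_gates m \<equiv> foldl (\<lambda>vs g. vs @ [gate_value m vs g])"

abbreviation gate_depths :: "nat list \<Rightarrow> gate list \<Rightarrow> nat list" where
  "gate_depths \<equiv> foldl (\<lambda>ds g. ds @ [Suc (Max (insert 0 ((\<lambda>i. ds ! i) ` set (gate_inputs g))))])"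

lemma length_foldl_snoc: "length (foldl (\<lambda>xs g. xs @ [f xs g]) ys gs) = length ys + length gs"
  by (induction gs arbitrary: ys) auto

text \<open>The circuit has \<open>N\<close> inputs, but they are functions on a cube of dimension
  \<open>n\<close>, and only that cube is measured. Input wires have depth 0 and allowed degree
  \<open>D ^ 0 = 1\<close>, which is why they must be affine. Each gate multiplies the largest
  degree of its inputs by \<open>D\<close> and adds one exceptional set.\<close>

lemma gates_approx:
  fixes p :: nat
  assumes p: "prime p" and D: "1 \<le> D" "t * (p - 1) \<le> D" "p ^ a \<le> D"
    and len: "\<And>S. length (inp S) = N"
    and inp: "\<forall>j < N. (\<lambda>S. of_bool (inp S ! j)) \<in> lowdeg n 1"
    and wf: "\<forall>k < length gs. \<forall>i \<in> set (gate_inputs (gs ! k)). i < N + k"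
  shows "\<exists>F. \<exists>E \<subseteq> Pow {..<n}. card E * 2 ^ t \<le> length gs * 2 ^ n \<and>
    (\<forall>i < N + length gs. F i \<in> lowdeg n (D ^ (gate_depths (replicate N 0) gs ! i)) \<and>
      (\<forall>S \<in> Pow {..<n} - E. [F i S = of_bool (eval_gates (p ^ a) (inp S) gs ! i)] (mod int p)))"
  using wf
proof (induction gs rule: rev_induct)
  case Nil
  then show ?case
    using inp by (intro exI[of _ "\<lambda>i S. of_bool (inp S ! i)"] exI[of _ "{}"]) auto
next
  case (snoc g gs)
  let ?ds = "gate_depths (replicate N 0) gs"
  let ?vs = "\<lambda>S. eval_gates (p ^ a) (inp S) gs"
  have wf': "\<forall>k < length gs. \<forall>i \<in> set (gate_inputs (gs ! k)). i < N + k"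
    using snoc.prems by (metis length_append_singleton less_SucI nth_append)
  obtain F E where E: "E \<subseteq> Pow {..<n}" "card E * 2 ^ t \<le> length gs * 2 ^ n"
    and FE': "\<forall>i < N + length gs. F i \<in> lowdeg n (D ^ (?ds ! i)) \<and>
      (\<forall>S \<in> Pow {..<n} - E. [F i S = of_bool (?vs S ! i)] (mod int p))"
    using snoc.IH[OF wf'] by (elim exE conjE)
  have F: "F i \<in> lowdeg n (D ^ (?ds ! i))" if "i < N + length gs" for i
    using FE' that by simp
  have FE: "[F i S = of_bool (?vs S ! i)] (mod int p)"
    if "i < N + length gs" "S \<in> Pow {..<n} - E" for i S
    using FE' that by simp
  have g: "i < N + length gs" if "i \<in> set (gate_inputs g)" for i
    using snoc.prems[rule_format, of "length gs" i] that by simp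
  let ?e = "Max (insert 0 ((\<lambda>i. ?ds ! i) ` set (gate_inputs g)))"
  have deg: "F i \<in> lowdeg n (D ^ ?e)" if "i \<in> set (gate_inputs g)" for i
    by (rule lowdeg_mono[OF F[OF g[OF that]]]) (use that D(1) in \<open>auto intro!: power_increasing\<close>)
  obtain Q E' where Q: "Q \<in> lowdeg n (D * D ^ ?e)"
    and E': "E' \<subseteq> Pow {..<n}" "card E' * 2 ^ t \<le> 2 ^ n"
    and QE: "\<forall>S \<in> Pow {..<n} - E'. \<forall>vs.
      (\<forall>i \<in> set (gate_inputs g). [F i S = of_bool (vs ! i)] (mod int p)) \<longrightarrow>
      [Q S = of_bool (gate_value (p ^ a) vs g)] (mod int p)"
    by (rule gate_approx[where g = g and F = F, OF p D]) (rule deg, assumption, rule that)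
  let ?F = "F(N + length gs := Q)"
  have "card (E \<union> E') * 2 ^ t \<le> (card E + card E') * 2 ^ t"
    by (intro mult_right_mono card_Un_le) simp
  also have "\<dots> \<le> length (gs @ [g]) * 2 ^ n" using E(2) E'(2) by (simp add: distrib_right)
  finally have "card (E \<union> E') * 2 ^ t \<le> length (gs @ [g]) * 2 ^ n" .
  moreover have "?F i \<in> lowdeg n (D ^ (gate_depths (replicate N 0) (gs @ [g]) ! i)) \<and>
      (\<forall>S \<in> Pow {..<n} - (E \<union> E').
        [?F i S = of_bool (eval_gates (p ^ a) (inp S) (gs @ [g]) ! i)] (mod int p))"
    if i: "i < N + length (gs @ [g])" for i
  proof (cases "i = N + length gs")
    case True
    have "[Q S = of_bool (gate_value (p ^ a) (?vs S) g)] (mod int p)" if "S \<in> Pow {..<n} - (E \<union> E')" for S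
      using that FE g by (intro QE[rule_format]) auto
    then show ?thesis using True Q by (simp add: nth_append length_foldl_snoc len)
  next
    case False
    then have "i < N + length gs" using i by simp
    then show ?thesis using F FE by (simp add: nth_append length_foldl_snoc len)
  qed
  ultimately show ?case using E(1) E'(1) by (intro exI[of _ ?F] exI[of _ "E \<union> E'"]) auto
qed

theorem circuit_approx:
  fixes p :: nat
  assumes p: "prime p" and D: "1 \<le> D" "t * (p - 1) \<le> D" "p ^ a \<le> D"
    and len: "\<And>S. length (inp S) = N"
    and inp: "\<forall>j < N. (\<lambda>S. of_bool (inp S ! j)) \<in> lowdeg n 1"
    and C: "wf_circuit N C" "circuit_depth N C \<le> h"
  shows "\<exists>P \<in> lowdeg n (D ^ h).
    card {S \<in> Pow {..<n}. \<not> [P S = of_bool (circuit_value (p ^ a) C (inp S))] (mod int p)} * 2 ^ t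
      \<le> circuit_size C * 2 ^ n"
proof -
  let ?o = "out_wire C"
  have wf: "\<forall>k < length (gates C). \<forall>i \<in> set (gate_inputs (gates C ! k)). i < N + k"
    and o: "?o < N + length (gates C)"
    using C(1) unfolding wf_circuit_def by blast+
  obtain F E where E: "E \<subseteq> Pow {..<n}" "card E * 2 ^ t \<le> length (gates C) * 2 ^ n"
    and FE': "\<forall>i < N + length (gates C). F i \<in> lowdeg n (D ^ (wire_depths N C ! i)) \<and>
      (\<forall>S \<in> Pow {..<n} - E. [F i S = of_bool (wire_values (p ^ a) C (inp S) ! i)] (mod int p))"
    using gates_approx[where inp = inp, OF p D len inp wf]
    unfolding wire_depths_def wire_values_def by (elim exE conjE)
  have F: "F ?o \<in> lowdeg n (D ^ (wire_depths N C ! ?o))" using FE' o by simp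
  have FE: "[F ?o S = of_bool (circuit_value (p ^ a) C (inp S))] (mod int p)"
    if "S \<in> Pow {..<n} - E" for S
    using FE' o that by (simp add: circuit_value_def)
  have "wire_depths N C ! ?o \<in> set (wire_depths N C)"
    using o by (intro nth_mem) (simp add: wire_depths_def length_foldl_snoc)
  then have "wire_depths N C ! ?o \<le> h"
    using C(2) unfolding circuit_depth_def by (auto intro: order.trans[OF Max_ge])
  then have "F ?o \<in> lowdeg n (D ^ h)"
    using D(1) by (intro lowdeg_mono[OF F] power_increasing) auto
  moreover have "card {S \<in> Pow {..<n}. \<not> [F ?o S = of_bool (circuit_value (p ^ a) C (inp S))] (mod int p)} * 2 ^ t
      \<le> circuit_size C * 2 ^ n" (is "card ?B * _ \<le> _")
  proof -
    have "?B \<subseteq> E" using FE by blast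
    then have "card ?B \<le> card E" using E(1) by (intro card_mono) (auto intro: finite_subset)
    then have "card ?B * 2 ^ t \<le> card E * 2 ^ t" by (rule mult_right_mono) simp
    also have "\<dots> \<le> length (gates C) * 2 ^ n" by (rule E(2))
    also have "\<dots> \<le> circuit_size C * 2 ^ n" unfolding circuit_size_def by (rule mult_right_mono) auto
    finally show ?thesis .
  qed
  ultimately show ?thesis by blast
qed

section \<open>Matchings in paths\<close>

lemma perfect_matching_mono:
  "perfect_matching V E M \<Longrightarrow> E \<subseteq> E' \<Longrightarrow> perfect_matching V E' M"
  unfolding perfect_matching_def by auto

lemma perfect_matching_Un:
  assumes M: "perfect_matching V E M" and M': "perfect_matching V' E' M'"
    and E: "\<Union>E \<subseteq> V" "\<Union>E' \<subseteq> V'" "V \<inter> V' = {}"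
  shows "perfect_matching (V \<union> V') (E \<union> E') (M \<union> M')"
proof -
  have "M \<subseteq> E" "M' \<subseteq> E'" using M M' unfolding perfect_matching_def by auto
  have "\<exists>!e. e \<in> M \<union> M' \<and> v \<in> e" if v: "v \<in> V \<union> V'" for v
  proof (cases "v \<in> V")
    case True
    then have "e \<in> M \<union> M' \<and> v \<in> e \<longleftrightarrow> e \<in> M \<and> v \<in> e" for e using \<open>M' \<subseteq> E'\<close> E by blast
    then show ?thesis using M True unfolding perfect_matching_def by simp
  next
    case False
    then have "e \<in> M \<union> M' \<and> v \<in> e \<longleftrightarrow> e \<in> M' \<and> v \<in> e" for e using \<open>M \<subseteq> E\<close> E by blast
    then show ?thesis using M' False v unfolding perfect_matching_def by simp
  qed
  then show ?thesis using \<open>M \<subseteq> E\<close> \<open>M' \<subseteq> E'\<close> unfolding perfect_matching_def by blast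
qed

lemma bipartite_Un:
  assumes "bipartite V E" "bipartite V' E'" "V \<inter> V' = {}"
  shows "bipartite (V \<union> V') (E \<union> E')"
proof -
  obtain A B where 1: "A \<union> B = V" "A \<inter> B = {}" "\<forall>e \<in> E. \<exists>a \<in> A. \<exists>b \<in> B. e = {a, b}"
    using assms(1) unfolding bipartite_def by blast
  obtain A' B' where 2: "A' \<union> B' = V'" "A' \<inter> B' = {}" "\<forall>e \<in> E'. \<exists>a \<in> A'. \<exists>b \<in> B'. e = {a, b}"
    using assms(2) unfolding bipartite_def by blast
  have "(A \<union> A') \<union> (B \<union> B') = V \<union> V'" using 1(1) 2(1) by blast
  moreover have "(A \<union> A') \<inter> (B \<union> B') = {}" using 1(1,2) 2(1,2) assms(3) by blast
  moreover have "\<forall>e \<in> E \<union> E'. \<exists>a \<in> A \<union> A'. \<exists>b \<in> B \<union> B'. e = {a, b}"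
    using 1(3) 2(3) unfolding ball_Un by (intro conjI; meson UnI1 UnI2)
  ultimately show ?thesis unfolding bipartite_def by blast
qed

text \<open>No edge leaves \<open>W\<close>, so the matching edges inside \<open>W\<close> partition
  it into pairs.\<close>

lemma perfect_matching_even_closed_set:
  assumes M: "perfect_matching V E M" and W: "W \<subseteq> V" "finite W"
    and E: "\<And>e. e \<in> E \<Longrightarrow> card e = 2" "\<And>e. e \<in> E \<Longrightarrow> e \<subseteq> W \<or> e \<inter> W = {}"
  shows "even (card W)"
proof -
  let ?N = "{e \<in> M. e \<subseteq> W}"
  have M': "M \<subseteq> E" "\<And>v. v \<in> V \<Longrightarrow> \<exists>!e. e \<in> M \<and> v \<in> e"
    using M unfolding perfect_matching_def by auto
  have "\<Union>?N = W"
  proof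
    show "W \<subseteq> \<Union>?N"
    proof
      fix v assume v: "v \<in> W"
      then obtain e where "e \<in> M" "v \<in> e" using M'(2) W(1) by blast
      moreover from this have "e \<subseteq> W" using E(2)[of e] M'(1) v by blast
      ultimately show "v \<in> \<Union>?N" by blast
    qed
  qed blast
  moreover have "2 * card ?N = card (\<Union>?N)"
  proof (rule card_partition)
    show "finite ?N" using W(2) by (rule_tac finite_subset[of _ "Pow W"]) auto
    show "finite (\<Union>?N)" using calculation W(2) by simp
    show "card e = 2" if "e \<in> ?N" for e using that M'(1) E(1) by blast
    show "e \<inter> f = {}" if "e \<in> ?N" "f \<in> ?N" "e \<noteq> f" for e f
    proof (rule ccontr)
      assume "e \<inter> f \<noteq> {}"
      then obtain v where "v \<in> e" "v \<in> f" by blast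
      moreover from this have "v \<in> V" using that(1) W(1) by blast
      ultimately show False using M'(2)[of v] that by blast
    qed
  qed
  ultimately show ?thesis by (metis dvd_triv_left)
qed

fun path_edges :: "'a list \<Rightarrow> 'a set set" where
  "path_edges [] = {}"
| "path_edges [x] = {}"
| "path_edges (x # y # zs) = insert {x, y} (path_edges (y # zs))"

lemma path_edges_snoc:
  "xs \<noteq> [] \<Longrightarrow> path_edges (xs @ [y]) = insert {last xs, y} (path_edges xs)"
  by (induction xs rule: path_edges.induct) auto

lemma path_edges_snoc2:
  "xs \<noteq> [] \<Longrightarrow> path_edges (xs @ [x, y]) = insert {x, y} (insert {last xs, x} (path_edges xs))"
  using path_edges_snoc[of "xs @ [x]" y] path_edges_snoc[of xs x] by simp

lemma path_edges_subset: "e \<in> path_edges xs \<Longrightarrow> e \<subseteq> set xs"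
  by (induction xs rule: path_edges.induct) auto

lemma card_path_edge: "distinct xs \<Longrightarrow> e \<in> path_edges xs \<Longrightarrow> card e = 2"
  by (induction xs rule: path_edges.induct) auto

lemma bipartite_path:
  "distinct xs \<Longrightarrow> bipartite (set xs) (path_edges xs)"
proof (induction xs rule: path_edges.induct)
  case 1
  show ?case unfolding bipartite_def by simp
next
  case (2 x)
  show ?case unfolding bipartite_def by (intro exI[of _ "{x}"] exI[of _ "{}"]) simp
next
  case (3 x y zs)
  then obtain A B where AB: "A \<union> B = set (y # zs)" "A \<inter> B = {}"
      "\<forall>e \<in> path_edges (y # zs). \<exists>a \<in> A. \<exists>b \<in> B. e = {a, b}"
    unfolding bipartite_def by auto
  have x: "x \<notin> A \<union> B" using 3(2) unfolding AB(1) by simp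
  have "y \<in> A \<union> B" unfolding AB(1) by simp
  then show ?case
  proof
    assume y: "y \<in> A"
    have "A \<union> insert x B = set (x # y # zs)" using AB(1) by auto
    moreover have "A \<inter> insert x B = {}" using AB(2) x by blast
    moreover have "\<forall>e \<in> path_edges (x # y # zs). \<exists>a \<in> A. \<exists>b \<in> insert x B. e = {a, b}"
      using AB(3) y by (simp, meson insert_commute)
    ultimately show ?thesis unfolding bipartite_def by blast
  next
    assume y: "y \<in> B"
    have "insert x A \<union> B = set (x # y # zs)" using AB(1) by auto
    moreover have "insert x A \<inter> B = {}" using AB(2) x by blast
    moreover have "\<forall>e \<in> path_edges (x # y # zs). \<exists>a \<in> insert x A. \<exists>b \<in> B. e = {a, b}"
      using AB(3) y by (simp, metis)
    ultimately show ?thesis unfolding bipartite_def by blast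
  qed
qed

text \<open>Matches the vertices in consecutive pairs from the start of the path.\<close>

lemma perfect_matching_path:
  "distinct xs \<Longrightarrow> even (length xs) \<Longrightarrow> \<exists>M. perfect_matching (set xs) (path_edges xs) M"
proof (induction xs rule: induct_list012)
  case 1
  show ?case unfolding perfect_matching_def by simp
next
  case (3 x y zs)
  then obtain M where "perfect_matching (set zs) (path_edges zs) M" by auto
  moreover have "perfect_matching {x, y} {{x, y}} {{x, y}}"
    unfolding perfect_matching_def by auto
  ultimately have "perfect_matching ({x, y} \<union> set zs) ({{x, y}} \<union> path_edges zs) ({{x, y}} \<union> M)"
    using 3(3) path_edges_subset[of _ zs] by (intro perfect_matching_Un) auto
  moreover have "path_edges zs \<subseteq> path_edges (y # zs)" by (cases zs) auto
  ultimately have "perfect_matching ({x, y} \<union> set zs) (path_edges (x # y # zs)) ({{x, y}} \<union> M)"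
    by (elim perfect_matching_mono) auto
  then show ?case by auto
qed simp

section \<open>The parity graph\<close>

text \<open>The test \<open>(n \<in> S) = (s = 1)\<close> serves both columns: for
  \<open>s = -1\<close> it reads \<open>n \<notin> S\<close>, so each vertex of column 0 lies on
  exactly one of the two paths.\<close>

primrec parity_path :: "nat set \<Rightarrow> int \<Rightarrow> nat \<Rightarrow> point list" where
  "parity_path S s 0 = [(s, 0)]"
| "parity_path S s (Suc n) =
     parity_path S s n @ (if (n \<in> S) = (s = 1) then [(0, int n)] else []) @ [(s, int (Suc n))]"

text \<open>The edges that one input bit controls. This local description is the one suited to
  planarity and to the encoding, whereas matchings are read off the two paths.\<close>

definition block :: "bool \<Rightarrow> int \<Rightarrow> point set set" where
  "block b y = (let s = if b then 1 else -1 in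
     {{(s, y), (0, y)}, {(0, y), (s, y + 1)}, {(- s, y), (- s, y + 1)}})"

definition parity_edges :: "nat set \<Rightarrow> nat \<Rightarrow> point set set" where
  "parity_edges S n = (\<Union>i<n. block (i \<in> S) (int i))"

text \<open>Listed by columns in an order free of \<open>S\<close>, so that the input affects
  nothing but the adjacency matrix.\<close>

definition parity_vertices :: "nat \<Rightarrow> point list" where
  "parity_vertices n = map (\<lambda>i. (1, int i)) [0..<Suc n] @ map (\<lambda>i. (-1, int i)) [0..<Suc n] @
     map (\<lambda>i. (0, int i)) [0..<n]"

lemma last_parity_path [simp]: "last (parity_path S s n) = (s, int n)"
  by (induction n) auto

lemma parity_path_nonempty [simp]: "parity_path S s n \<noteq> []"
  by (induction n) auto

lemma set_parity_path:
  "set (parity_path S s n) =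
    (\<lambda>i. (s, int i)) ` {..n} \<union> (\<lambda>i. (0, int i)) ` {i \<in> {..<n}. (i \<in> S) = (s = 1)}"
  by (induction n) (auto simp: lessThan_Suc atMost_Suc)

lemma distinct_parity_path: "s \<noteq> 0 \<Longrightarrow> distinct (parity_path S s n)"
  by (induction n) (auto simp: set_parity_path)

lemma length_parity_path:
  "length (parity_path S s n) = Suc n + card {i \<in> {..<n}. (i \<in> S) = (s = 1)}"
proof (induction n)
  case (Suc n)
  have "{i \<in> {..<Suc n}. (i \<in> S) = (s = 1)} =
      (if (n \<in> S) = (s = 1) then insert n else id) {i \<in> {..<n}. (i \<in> S) = (s = 1)}"
    by (auto simp: less_Suc_eq)
  then show ?case using Suc by simp
qed simp

lemma parity_edges_eq_paths:
  "parity_edges S n = path_edges (parity_path S 1 n) \<union> path_edges (parity_path S (-1) n)"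
proof (induction n)
  case 0
  then show ?case by (simp add: parity_edges_def)
next
  case (Suc n)
  have step: "parity_edges S (Suc n) = parity_edges S n \<union> block (n \<in> S) (int n)"
    unfolding parity_edges_def by (auto simp: lessThan_Suc)
  show ?case
    unfolding step Suc.IH
    by (cases "n \<in> S"; simp add: block_def Let_def path_edges_snoc path_edges_snoc2 add.commute; blast)
qed

lemma parity_paths_vertices:
  "set (parity_path S 1 n) \<union> set (parity_path S (-1) n) = set (parity_vertices n)"
  unfolding set_parity_path parity_vertices_def by (auto simp del: upt_Suc)

lemma parity_paths_disjoint:
  "set (parity_path S 1 n) \<inter> set (parity_path S (-1) n) = {}"
  unfolding set_parity_path by auto

lemma simple_parity_graph: "simple_graph (set (parity_vertices n)) (parity_edges S n)"
proof -
  have "e \<subseteq> set (parity_vertices n) \<and> card e = 2" if e: "e \<in> path_edges (parity_path S s n)"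
    and s: "s = 1 \<or> s = -1" for e s
  proof
    have "set (parity_path S s n) \<subseteq> set (parity_vertices n)"
      using s parity_paths_vertices by blast
    then show "e \<subseteq> set (parity_vertices n)" using path_edges_subset[OF e] by (rule order.trans[rotated])
    have "distinct (parity_path S s n)" using s by (intro distinct_parity_path) auto
    then show "card e = 2" using e by (rule card_path_edge)
  qed
  then show ?thesis unfolding simple_graph_def parity_edges_eq_paths by blast
qed

lemma bipartite_parity_graph: "bipartite (set (parity_vertices n)) (parity_edges S n)"
  unfolding parity_edges_eq_paths parity_paths_vertices[symmetric, of n S]
  by (intro bipartite_Un bipartite_path distinct_parity_path parity_paths_disjoint) simp_all

text \<open>No edge joins the two paths, so a perfect matching forces the first one, with
  \<open>n + 1 + card S\<close> vertices, to be even. Conversely, for even \<open>n\<close> and odd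
  \<open>card S\<close> both paths are even and can be matched separately.\<close>

lemma perfect_matching_parity_graph_iff:
  assumes "even n" "S \<subseteq> {..<n}"
  shows "(\<exists>M. perfect_matching (set (parity_vertices n)) (parity_edges S n) M) \<longleftrightarrow> odd (card S)"
proof
  let ?P = "parity_path S 1 n" and ?Q = "parity_path S (-1) n"
  have fin: "finite S" using assms(2) by (rule finite_subset) simp
  have S: "{i \<in> {..<n}. (i \<in> S) = ((1 :: int) = 1)} = S"
    "{i \<in> {..<n}. (i \<in> S) = ((-1 :: int) = 1)} = {..<n} - S"
    using assms(2) by auto
  have P: "length ?P = Suc n + card S" unfolding length_parity_path S(1) ..
  have dist: "distinct ?P" "distinct ?Q" by (intro distinct_parity_path; simp)+
  {
    assume "\<exists>M. perfect_matching (set (parity_vertices n)) (parity_edges S n) M"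
    then obtain M where "perfect_matching (set (parity_vertices n)) (parity_edges S n) M" ..
    then have "even (card (set ?P))"
    proof (rule perfect_matching_even_closed_set)
      show "set ?P \<subseteq> set (parity_vertices n)" using parity_paths_vertices by blast
      show "card e = 2" if "e \<in> parity_edges S n" for e
        using that simple_parity_graph unfolding simple_graph_def by blast
      show "e \<subseteq> set ?P \<or> e \<inter> set ?P = {}" if "e \<in> parity_edges S n" for e
        using that path_edges_subset[of e ?P] path_edges_subset[of e ?Q] parity_paths_disjoint[of S n]
        unfolding parity_edges_eq_paths by blast
    qed simp
    then show "odd (card S)" using P assms(1) dist by (simp add: distinct_card)
  }
  assume odd: "odd (card S)"
  have "length ?Q = Suc n + (n - card S)"
    unfolding length_parity_path S(2) using assms(2) fin by (simp add: card_Diff_subset)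
  moreover have "card S \<le> n" using card_mono[OF _ assms(2)] by simp
  ultimately have "even (length ?Q)" "even (length ?P)" using odd assms(1) P by simp_all
  then obtain M M' where "perfect_matching (set ?P) (path_edges ?P) M"
      "perfect_matching (set ?Q) (path_edges ?Q) M'"
    using perfect_matching_path dist by metis
  then have "perfect_matching (set ?P \<union> set ?Q) (path_edges ?P \<union> path_edges ?Q) (M \<union> M')"
    using path_edges_subset parity_paths_disjoint by (intro perfect_matching_Un) blast+
  then show "\<exists>M. perfect_matching (set (parity_vertices n)) (parity_edges S n) M"
    unfolding parity_edges_eq_paths parity_paths_vertices by blast
qed

section \<open>The straight-line drawing is plane\<close>

text \<open>The edge of a block that contains a given non-lattice point. Diagonals rise away from column
  0, hence the case distinction on the sign of \<open>x\<close>.\<close>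

definition unit_edge_at :: "real \<times> real \<Rightarrow> point set" where
  "unit_edge_at = (\<lambda>(x, y). if 0 \<le> x then {(\<lfloor>x\<rfloor>, \<lfloor>y\<rfloor>), (\<lceil>x\<rceil>, \<lceil>y\<rceil>)} else {(\<lceil>x\<rceil>, \<lfloor>y\<rfloor>), (\<lfloor>x\<rfloor>, \<lceil>y\<rceil>)})"

lemma segment_doubletonE:
  assumes "z \<in> segment {(a, b), (c, d)}"
  obtains "z \<in> real_point ` {(a, b), (c, d)}"
  | u where "0 < u" "u < 1"
    "z = (real_of_int a + u * real_of_int (c - a), real_of_int b + u * real_of_int (d - b))"
proof -
  have "z \<in> closed_segment (real_point (a, b)) (real_point (c, d))"
    using assms unfolding segment_def by (simp add: segment_convex_hull)
  then obtain u where u: "0 \<le> u" "u \<le> 1"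
      "z = (1 - u) *\<^sub>R real_point (a, b) + u *\<^sub>R real_point (c, d)"
    unfolding closed_segment_def by blast
  consider "u = 0" | "u = 1" | "0 < u" "u < 1" using u(1,2) by linarith
  then show thesis
  proof cases
    case 3
    then show thesis using u(3) that(2) by (simp add: real_point_def algebra_simps)
  qed (use u(3) that(1) in auto)
qed

lemma unit_interval_no_int:
  assumes "0 < u" "u < 1"
  shows "real_of_int a + u \<noteq> real_of_int b" "real_of_int a - u \<noteq> real_of_int b"
proof -
  show "real_of_int a + u \<noteq> real_of_int b"
  proof
    assume "real_of_int a + u = real_of_int b"
    then have "a < b" "b < a + 1" using assms by linarith+
    then show False by simp
  qed
  show "real_of_int a - u \<noteq> real_of_int b"
  proof
    assume "real_of_int a - u = real_of_int b"
    then have "b < a" "a < b + 1" using assms by linarith+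
    then show False by simp
  qed
qed

text \<open>Rounding an interior point recovers its edge, by a rule that refers neither to the row
  nor to the bit. Two edges of arbitrary blocks that share a non-lattice point are therefore equal,
  which excludes crossings without comparing pairs of edges.\<close>

lemma block_segment_cases:
  assumes "e \<in> block b y" "z \<in> segment e"
  shows "z \<in> real_point ` e \<or> z \<notin> range real_point \<and> unit_edge_at z = e"
proof -
  define s :: int where "s = (if b then 1 else -1)"
  have s: "s = 1 \<or> s = -1" unfolding s_def by simp
  have fc: "\<lfloor>real_of_int a + u\<rfloor> = a" "\<lceil>real_of_int a + u\<rceil> = a + 1" "\<lfloor>u\<rfloor> = 0" "\<lceil>u\<rceil> = 1"
    "\<lfloor>- u\<rfloor> = -1" "\<lceil>- u\<rceil> = 0"
    if "0 < u" "u < 1" for u and a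
    using that by linarith+
  have no: "u \<noteq> real_of_int a" "- u \<noteq> real_of_int a" if "0 < u" "u < 1" for u a
    using unit_interval_no_int[OF that, of 0 a] by simp_all
  consider "e = {(0, y), (s, y)}" | "e = {(0, y), (s, y + 1)}" | "e = {(- s, y), (- s, y + 1)}"
    using assms(1) unfolding block_def s_def by (auto simp: Let_def insert_commute split: if_splits)
  then show ?thesis
  proof cases
    case 1
    from assms(2)[unfolded 1] show ?thesis unfolding 1
    proof (cases rule: segment_doubletonE)
      case (2 u)
      then show "z \<in> real_point ` {(0, y), (s, y)} \<or>
          z \<notin> range real_point \<and> unit_edge_at z = {(0, y), (s, y)}"
        using s fc[OF 2(1,2)] no[OF 2(1,2)]
        by (auto simp: unit_edge_at_def real_point_def insert_commute)
    qed simp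
  next
    case 2
    from assms(2)[unfolded 2] show ?thesis unfolding 2
    proof (cases rule: segment_doubletonE)
      case (2 u)
      then show "z \<in> real_point ` {(0, y), (s, y + 1)} \<or>
          z \<notin> range real_point \<and> unit_edge_at z = {(0, y), (s, y + 1)}"
        using s fc[OF 2(1,2)] no[OF 2(1,2)]
        by (auto simp: unit_edge_at_def real_point_def insert_commute)
    qed simp
  next
    case 3
    from assms(2)[unfolded 3] show ?thesis unfolding 3
    proof (cases rule: segment_doubletonE)
      case (2 u)
      then show "z \<in> real_point ` {(- s, y), (- s, y + 1)} \<or>
          z \<notin> range real_point \<and> unit_edge_at z = {(- s, y), (- s, y + 1)}"
        using s fc[OF 2(1,2)] unit_interval_no_int[OF 2(1,2)] ceiling_of_int[of "-1", where 'a = real]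
        by (auto simp: unit_edge_at_def real_point_def insert_commute)
    qed simp
  qed
qed

lemma plane_drawing_blocks:
  assumes E: "\<And>e. e \<in> E \<Longrightarrow> e \<subseteq> V" "\<And>e. e \<in> E \<Longrightarrow> \<exists>b y. e \<in> block b y"
  shows "plane_drawing V E"
proof -
  have sub: "real_point ` e \<subseteq> segment e" for e unfolding segment_def by (rule hull_subset)
  have inj: "inj real_point" by (rule injI) (auto simp: real_point_def)
  have seg: "z \<in> real_point ` e \<or> z \<notin> range real_point \<and> unit_edge_at z = e"
    if "e \<in> E" "z \<in> segment e" for e z
    using E(2)[OF that(1)] block_segment_cases that(2) by blast
  have "segment e \<inter> real_point ` V = real_point ` e" if "e \<in> E" for e
    using seg[OF that] sub[of e] E(1)[OF that] by blast
  moreover have "segment e \<inter> segment f = real_point ` (e \<inter> f)" if "e \<in> E" "f \<in> E" "e \<noteq> f" for e f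
  proof -
    have "z \<in> real_point ` e \<inter> real_point ` f" if z: "z \<in> segment e" "z \<in> segment f" for z
      using seg[OF \<open>e \<in> E\<close> z(1)] seg[OF \<open>f \<in> E\<close> z(2)] \<open>e \<noteq> f\<close> by blast
    then have "segment e \<inter> segment f = real_point ` e \<inter> real_point ` f"
      using sub[of e] sub[of f] by blast
    then show ?thesis by (simp add: image_Int[OF inj])
  qed
  ultimately show ?thesis unfolding plane_drawing_def by blast
qed

lemma grid_layered_planar_parity_graph:
  "grid_layered_planar (set (parity_vertices n)) (parity_edges S n)"
proof -
  have "plane_drawing (set (parity_vertices n)) (parity_edges S n)"
  proof (rule plane_drawing_blocks)
    show "e \<subseteq> set (parity_vertices n)" if "e \<in> parity_edges S n" for e
      using that simple_parity_graph unfolding simple_graph_def by blast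
    show "\<exists>b y. e \<in> block b y" if "e \<in> parity_edges S n" for e
      using that unfolding parity_edges_def by blast
  qed
  moreover have "\<bar>a - c\<bar> \<le> 1" if "{(a, b), (c, d)} \<in> parity_edges S n" for a b c d
    using that unfolding parity_edges_def block_def
    by (auto simp: Let_def doubleton_eq_iff split: if_splits)
  ultimately show ?thesis using simple_parity_graph unfolding grid_layered_planar_def by blast
qed

text \<open>Width \<open>n\<close> already suffices for the rows, since \<open>n < 2 ^ n\<close>;
  one more bit makes column 1 fit when \<open>n = 0\<close> as well. A width linear in
  \<open>n\<close> keeps the unary part and the coordinates short.\<close>

definition parity_code :: "nat \<Rightarrow> nat set \<Rightarrow> bool list" where
  "parity_code n S = encode_graph (Suc n) (parity_vertices n) (parity_edges S n)"

text \<open>Membership only asserts that some suitable graph has this code. Since decoding is unique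
  among simple graphs, that graph is the parity graph.\<close>

lemma parity_code_in_BGGM_iff:
  assumes "even n" "S \<subseteq> {..<n}"
  shows "parity_code n S \<in> BGGM \<longleftrightarrow> odd (card S)"
proof -
  let ?V = "set (parity_vertices n)" and ?E = "parity_edges S n"
  have "distinct (parity_vertices n)"
    unfolding parity_vertices_def by (auto simp: distinct_map inj_on_def simp del: upt_Suc)
  moreover have "\<forall>(a, b) \<in> ?V. a \<in> {- (2 ^ Suc n)..<2 ^ Suc n} \<and> b \<in> {- (2 ^ Suc n)..<2 ^ Suc n}"
  proof -
    have "int i < 2 ^ Suc n" if "i \<le> n" for i
    proof -
      have "int (Suc n) < 2 ^ Suc n" by (rule of_nat_less_two_power)
      then show ?thesis using that by linarith
    qed
    moreover have "(1 :: int) < 2 ^ Suc n" by (rule one_less_power) simp_all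
    moreover have "- (2 ^ Suc n) \<le> int i" for i by (rule order.trans[of _ 0]) simp_all
    moreover have "(-1 :: int) < 2 ^ Suc n" by (rule less_trans[of _ 0]) simp_all
    ultimately show ?thesis unfolding parity_vertices_def
      by (auto simp: less_imp_le simp del: upt_Suc power_Suc)
  qed
  ultimately have enc: "encodes (parity_code n S) ?V ?E"
    unfolding encodes_def parity_code_def by blast
  have "parity_code n S \<in> BGGM \<longleftrightarrow> (\<exists>M. perfect_matching ?V ?E M)"
  proof
    assume "parity_code n S \<in> BGGM"
    then obtain V E M where *: "encodes (parity_code n S) V E" "grid_layered_planar V E"
        "perfect_matching V E M"
      unfolding BGGM_def by blast
    then have "V = ?V \<and> E = ?E"
      using encodes_unique[OF _ enc _ simple_parity_graph] unfolding grid_layered_planar_def by blast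
    then show "\<exists>M. perfect_matching ?V ?E M" using * by blast
  next
    assume "\<exists>M. perfect_matching ?V ?E M"
    then show "parity_code n S \<in> BGGM"
      unfolding BGGM_def using enc grid_layered_planar_parity_graph bipartite_parity_graph by blast
  qed
  then show ?thesis using perfect_matching_parity_graph_iff[OF assms] by simp
qed

section \<open>The encoding is affine in the input\<close>

text \<open>The length is common to all \<open>S\<close>, so that a single circuit of the family
  receives all the strings \<open>F S\<close>.\<close>

definition affine_bits :: "nat \<Rightarrow> nat \<Rightarrow> (nat set \<Rightarrow> bool list) \<Rightarrow> bool" where
  "affine_bits n l F \<longleftrightarrow>
     (\<forall>S. length (F S) = l) \<and> (\<forall>j<l. (\<lambda>S. of_bool (F S ! j)) \<in> lowdeg n 1)"

lemma affine_bits_const: "affine_bits n (length xs) (\<lambda>_. xs)"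
  unfolding affine_bits_def by simp

lemma affine_bits_append:
  assumes "affine_bits n l F" "affine_bits n l' G"
  shows "affine_bits n (l + l') (\<lambda>S. F S @ G S)"
  unfolding affine_bits_def
proof (intro conjI allI impI)
  show "length (F S @ G S) = l + l'" for S using assms unfolding affine_bits_def by simp
  show "(\<lambda>S. of_bool ((F S @ G S) ! j)) \<in> lowdeg n 1" if "j < l + l'" for j
    using assms that unfolding affine_bits_def by (cases "j < l") (simp_all add: nth_append)
qed

lemma affine_bits_concat:
  assumes "\<And>u. u \<in> set us \<Longrightarrow> affine_bits n l (G u)"
  shows "affine_bits n (length us * l) (\<lambda>S. concat (map (\<lambda>u. G u S) us))"
  using assms
proof (induction us)
  case Nil
  show ?case by (simp add: affine_bits_def)
next
  case (Cons u us)
  then show ?case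
    using affine_bits_append[of n l "G u" "length us * l" "\<lambda>S. concat (map (\<lambda>u. G u S) us)"] by simp
qed

lemma affine_bits_map:
  assumes "\<And>v. v \<in> set vs \<Longrightarrow> (\<lambda>S. of_bool (g v S)) \<in> lowdeg n 1"
  shows "affine_bits n (length vs) (\<lambda>S. map (\<lambda>v. g v S) vs)"
  using assms unfolding affine_bits_def by simp

text \<open>An edge reveals its row, so blocks of different rows are disjoint and the presence of a
  given edge depends on at most one input bit.\<close>

lemma block_lowest_row:
  assumes "e \<in> block b y"
  shows "Min (snd ` e) = y"
  using assms by (auto simp: block_def Let_def)

lemma parity_edge_affine: "(\<lambda>S. of_bool (e \<in> parity_edges S n)) \<in> lowdeg n 1"
proof -
  let ?f = "\<lambda>S. \<Sum>i<n. of_bool (i \<in> S) * of_bool (e \<in> block True (int i)) +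
    (1 - of_bool (i \<in> S)) * of_bool (e \<in> block False (int i)) :: int"
  have "?f \<in> lowdeg n 1"
  proof (intro lowdeg_sum lowdeg_add)
    fix i assume i: "i \<in> {..<n}"
    then have c: "(\<lambda>S. of_bool (i \<in> S)) \<in> lowdeg n 1" by (intro lowdeg_coord) auto
    show "(\<lambda>S. of_bool (i \<in> S) * of_bool (e \<in> block True (int i))) \<in> lowdeg n 1"
      using lowdeg_mult[OF c lowdeg_const[of _ n 0]] by simp
    show "(\<lambda>S. (1 - of_bool (i \<in> S)) * of_bool (e \<in> block False (int i))) \<in> lowdeg n 1"
      using lowdeg_mult[OF lowdeg_diff[OF lowdeg_const c] lowdeg_const[of _ n 0]] by simp
  qed
  moreover have "?f S = of_bool (e \<in> parity_edges S n)" for S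
  proof -
    have "of_bool (i \<in> S) * of_bool (e \<in> block True (int i)) +
        (1 - of_bool (i \<in> S)) * of_bool (e \<in> block False (int i)) =
        (of_bool (e \<in> block (i \<in> S) (int i)) :: int)" for i
      by (cases "i \<in> S") simp_all
    then have "?f S = (\<Sum>i<n. of_bool (e \<in> block (i \<in> S) (int i)))" by (simp only:)
    \<comment> \<open>At most one row can contain \<open>e\<close>, hence the sum of the indicators
      is again 0 or 1.\<close>
    also have "\<dots> = of_bool (e \<in> parity_edges S n)"
    proof (cases "e \<in> parity_edges S n")
      case True
      then obtain j where j: "j < n" "e \<in> block (j \<in> S) (int j)" unfolding parity_edges_def by blast
      have "i = j" if "e \<in> block (i \<in> S) (int i)" for i
        using block_lowest_row[OF that] block_lowest_row[OF j(2)] by simp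
      then have "e \<in> block (i \<in> S) (int i) \<longleftrightarrow> i = j" for i using j(2) by blast
      then have "(\<Sum>i<n. of_bool (e \<in> block (i \<in> S) (int i)) :: int) = (\<Sum>i<n. if i = j then 1 else 0)"
        by (intro sum.cong) auto
      then show ?thesis using True j(1) by simp
    next
      case False
      then show ?thesis unfolding parity_edges_def by (intro trans[OF sum.neutral]) auto
    qed
    finally show ?thesis .
  qed
  ultimately show ?thesis by (rule lowdeg_cong)
qed

text \<open>With \<open>3 * n + 2\<close> vertices, the unary header takes \<open>4 * n + 5\<close>
  bits, the coordinates \<open>(3 * n + 2) * (2 * n + 4)\<close> and the matrix
  \<open>(3 * n + 2)\<^sup>2\<close>.\<close>

lemma affine_bits_parity_code:
  "affine_bits n (15 * n\<^sup>2 + 32 * n + 17) (parity_code n)"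
proof -
  let ?vs = "parity_vertices n"
  let ?head = "replicate (length ?vs) True @ [False] @ replicate (Suc n) True @ [False]"
  let ?coords = "\<lambda>(a, b). int_bits (Suc n) a @ int_bits (Suc n) b"
  have len: "length ?vs = 3 * n + 2" unfolding parity_vertices_def by simp
  have coords: "affine_bits n (2 * n + 4) (\<lambda>_. ?coords v)" for v
  proof -
    have "length (?coords v) = 2 * n + 4" by (simp add: int_bits_def case_prod_beta del: upt_Suc)
    then show ?thesis using affine_bits_const[of n "?coords v"] by simp
  qed
  have "affine_bits n (length ?head +
      (length ?vs * (2 * n + 4) + length ?vs * length ?vs))
    (\<lambda>S. ?head @ concat (map ?coords ?vs) @
      concat (map (\<lambda>u. map (\<lambda>v. {u, v} \<in> parity_edges S n) ?vs) ?vs))"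
    by (intro affine_bits_append affine_bits_const affine_bits_concat affine_bits_map coords
        parity_edge_affine)
  moreover have "length ?head + (length ?vs * (2 * n + 4) + length ?vs * length ?vs) =
      15 * n\<^sup>2 + 32 * n + 17"
    unfolding len by (simp add: len power2_eq_square algebra_simps)
  ultimately show ?thesis unfolding parity_code_def[abs_def] encode_graph_def by (simp only: append_assoc)
qed

section \<open>The lower bound\<close>

lemma square_le_two_power: "4 \<le> n \<Longrightarrow> n\<^sup>2 \<le> (2 :: nat) ^ n"
proof (induction n rule: dec_induct)
  case (step n)
  have "4 * n \<le> n * n" using step.hyps by (intro mult_right_mono) auto
  then have "n * n + n + n + 1 \<le> 2 * (n * n)" using step.hyps by linarith
  then have "(Suc n)\<^sup>2 \<le> 2 * n\<^sup>2" by (simp add: power2_eq_square)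
  then show ?case using step.IH by simp
qed simp

text \<open>The witness is \<open>s = 2 ^ r\<close>: then \<open>A * s ^ K\<close> is at most
  \<open>2 ^ (A + r * K)\<close>, and the exponent is below
  \<open>r\<^sup>2 \<le> 2 ^ r\<close>.\<close>

lemma exists_power_less_two_power:
  fixes A K B :: nat
  shows "\<exists>s\<ge>B. A * s ^ K < 2 ^ s"
proof -
  define r where "r = A + K + B + 4"
  have "A + r * K \<le> r * (A + K)" unfolding r_def by (simp add: algebra_simps)
  also have "\<dots> < r * r" unfolding r_def by (intro mult_strict_left_mono) auto
  also have "\<dots> \<le> 2 ^ r" using square_le_two_power[of r] unfolding r_def by (simp add: power2_eq_square)
  finally have *: "A + r * K < 2 ^ r" .
  have "A * (2 ^ r) ^ K \<le> 2 ^ A * 2 ^ (r * K)"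
    by (simp add: power_mult less_imp_le)
  also have "\<dots> < 2 ^ 2 ^ r" using * by (simp flip: power_add)
  finally have "A * (2 ^ r) ^ K < 2 ^ 2 ^ r" .
  moreover have "B \<le> 2 ^ r"
    using less_exp[of r] unfolding r_def by linarith
  ultimately show ?thesis by blast
qed

theorem theorem9:
  fixes p \<alpha> :: nat
  assumes "prime p" and "odd p"
  shows "BGGM \<notin> AC0_mod (p ^ \<alpha>)"
proof
  assume "BGGM \<in> AC0_mod (p ^ \<alpha>)"
  then obtain C :: "nat \<Rightarrow> circuit" and d k where C:
      "\<And>N. wf_circuit N (C N)" "\<And>N. circuit_depth N (C N) \<le> d" "\<And>N. circuit_size (C N) \<le> N ^ k + k"
      "\<And>xs. circuit_value (p ^ \<alpha>) (C (length xs)) xs \<longleftrightarrow> xs \<in> BGGM"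
    unfolding AC0_mod_def by blast
  \<comment> \<open>The part of \<open>D\<close> that does not depend on \<open>s\<close>, so that
    \<open>D = c * s\<close>.\<close>
  define c where "c = p * p ^ \<alpha> * (3 * k + 3)"
  \<comment> \<open>The lower bound gives \<open>32 \<le> n\<close> and \<open>k \<le> n\<close>.
    The inequality says \<open>64 * (D ^ d)\<^sup>2 < n\<close>, where 64 is 16 times the 4 from
    \<open>D ^ d + 1 \<le> 2 * D ^ d\<close>.\<close>
  obtain s where s: "5 + k \<le> s" "64 * c ^ (2 * d) * s ^ (2 * d) < 2 ^ s"
    using exists_power_less_two_power by blast
  \<comment> \<open>\<open>t\<close> is chosen to make \<open>2 ^ t = n ^ (3 * k + 3)\<close>; the
    factors \<open>p\<close> and \<open>p ^ \<alpha>\<close> of \<open>D\<close> cover the degree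
    growth at OR and Mod gates.\<close>
  define n m t D where defs: "n = (2 :: nat) ^ s" "m = (2 :: nat) ^ (s - 1)"
    "t = s * (3 * k + 3)" "D = p * p ^ \<alpha> * t"
  have n: "n = 2 * m" using s(1) unfolding defs by (cases s) auto
  have pos: "0 < p" "0 < p ^ \<alpha>" "0 < t" using assms(1) s(1) unfolding defs by (auto simp: prime_gt_0_nat)
  have D: "1 \<le> D" "t * (p - 1) \<le> D" "p ^ \<alpha> \<le> D"
  proof -
    show "1 \<le> D" using pos unfolding defs(4) by (simp add: Suc_le_eq)
    have "(p - 1) * 1 * t \<le> p * p ^ \<alpha> * t" using pos by (intro mult_mono) (auto simp: Suc_le_eq)
    then show "t * (p - 1) \<le> D" unfolding defs(4) by (simp add: mult.commute)
    have "1 * p ^ \<alpha> * 1 \<le> p * p ^ \<alpha> * t" using pos by (intro mult_mono) (auto simp: Suc_le_eq)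
    then show "p ^ \<alpha> \<le> D" unfolding defs(4) by simp
  qed
  define N where "N = 15 * n\<^sup>2 + 32 * n + 17"
  have code: "length (parity_code n S) = N"
    "\<forall>j < N. (\<lambda>S. of_bool (parity_code n S ! j)) \<in> lowdeg n 1" for S
    using affine_bits_parity_code[of n] unfolding affine_bits_def N_def by auto
  obtain P where P: "P \<in> lowdeg n (D ^ d)"
    and err: "card {S \<in> Pow {..<n}.
        \<not> [P S = of_bool (circuit_value (p ^ \<alpha>) (C N) (parity_code n S))] (mod int p)} * 2 ^ t
      \<le> circuit_size (C N) * 2 ^ n"
    using circuit_approx[OF assms(1) D code C(1,2)] by (elim bexE)
  \<comment> \<open>On codes of parity graphs the circuit computes parity, so \<open>P\<close>
    approximates parity on the cube.\<close>
  have "circuit_value (p ^ \<alpha>) (C N) (parity_code n S) \<longleftrightarrow> odd (card S)" if "S \<in> Pow {..<n}" for S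
    using C(4)[of "parity_code n S"] parity_code_in_BGGM_iff[of n S] that code(1) n by simp
  then have "{S \<in> Pow {..<n}.
        \<not> [P S = of_bool (circuit_value (p ^ \<alpha>) (C N) (parity_code n S))] (mod int p)} =
      {S \<in> Pow {..<2 * m}. \<not> [P S = of_bool (odd (card S))] (mod int p)}"
    unfolding n by (intro Collect_cong conj_cong refl) simp
  then have err': "card {S \<in> Pow {..<2 * m}. \<not> [P S = of_bool (odd (card S))] (mod int p)} * 2 ^ t
      \<le> circuit_size (C N) * 2 ^ n" (is "card ?B * _ \<le> _")
    using err by simp
  \<comment> \<open>Since \<open>N \<le> n ^ 3\<close> and \<open>k \<le> n\<close>, the size is at
    most \<open>(n + 1) * n ^ (3 * k)\<close>; one more factor \<open>n ^ 3\<close> absorbs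
    \<open>4 * (n + 1)\<close>.\<close>
  have size: "4 * circuit_size (C N) \<le> 2 ^ t"
  proof -
    have "32 \<le> n" using power_increasing[of 5 s "2 :: nat"] s(1) unfolding defs by simp
    have "k \<le> n" using less_exp[of s] s(1) unfolding defs(1) by linarith
    have sq: "32 * n \<le> n\<^sup>2" "17 \<le> n\<^sup>2"
    proof -
      show 1: "32 * n \<le> n\<^sup>2" using \<open>32 \<le> n\<close> by (simp add: power2_eq_square)
      show "17 \<le> n\<^sup>2" using 1 \<open>32 \<le> n\<close> by linarith
    qed
    have cube: "32 * n\<^sup>2 \<le> n ^ 3"
      using \<open>32 \<le> n\<close> by (simp add: power2_eq_square power3_eq_cube)
    have "N \<le> n ^ 3" using sq cube unfolding N_def by linarith
    then have "N ^ k + k \<le> n ^ (3 * k) + n * n ^ (3 * k)"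
      using \<open>k \<le> n\<close> \<open>32 \<le> n\<close> power_mono[of N "n ^ 3" k]
      by (intro add_mono) (auto simp: power_mult intro: order.trans[of _ "n * 1"])
    then have "4 * circuit_size (C N) \<le> (4 + 4 * n) * n ^ (3 * k)"
      using C(3)[of N] by (simp add: distrib_right)
    also have "\<dots> \<le> n ^ 3 * n ^ (3 * k)"
      using sq cube \<open>32 \<le> n\<close> by (intro mult_right_mono) linarith+
    also have "\<dots> = n ^ (3 * k + 3)" by (simp add: power_add)
    also have "\<dots> = 2 ^ t" unfolding defs by (simp add: power_mult)
    finally show ?thesis .
  qed
  have "4 * card ?B * 2 ^ t \<le> 4 * circuit_size (C N) * 2 ^ n" using err' by simp
  also have "\<dots> \<le> 2 ^ t * 2 ^ n" using size by (rule mult_right_mono) simp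
  finally have "4 * card ?B \<le> 2 ^ n" by (simp add: mult.commute)
  then have "4 * card ?B \<le> 4 ^ m" unfolding n by (simp add: power_mult)
  moreover have "4 ^ m < 4 * card ?B"
  proof (rule parity_not_approximable[OF assms])
    show "P \<in> lowdeg (2 * m) (D ^ d)" using P unfolding n .
    have "(D ^ d + 1)\<^sup>2 \<le> (2 * D ^ d)\<^sup>2" using D(1) by (intro power_mono) auto
    then have "16 * (D ^ d + 1)\<^sup>2 \<le> 64 * (D ^ d)\<^sup>2" by (simp add: power_mult_distrib)
    also have "\<dots> = 64 * c ^ (2 * d) * s ^ (2 * d)"
    proof -
      have "D = c * s" unfolding defs c_def by simp
      then show ?thesis by (simp add: power_mult_distrib power_mult mult.commute[of 2 d])
    qed
    also have "\<dots> < 2 * m + 1" using s(2) n unfolding defs(1) by simp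
    finally show "16 * (D ^ d + 1)\<^sup>2 < 2 * m + 1" .
  qed
  ultimately show False by simp
qed

end
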